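(* The family of uniformly recurrent tree sets is closed under maximal bifix decoding. That is: let $A$ be a finite alphabet, let $S\subset A^*$ be a uniformly recurrent tree set, let $Z\subset S$ be a finite $S$-maximal bifix code, and let $f:B^*\to A^*$ be a coding morphism for $Z$. Then $f^{-1}(S)\subset B^*$ is a uniformly recurrent tree set.
   Context: Words and sets. $A$ is a finite nonempty alphabet, $A^*$ the free monoid of finite words over $A$, $A^+$ the set of nonempty words, and $1$ (or $\varepsilon$) the empty word. A set $S$ of words is factorial if it contains all factors of its elements. A factorial set $S$ is right-extendable if for every $w\in S$ there is a letter $a$ with $wa\in S$, and biextendable if for every $w\in S$ there are letters $a,b$ with $awb\in S$. A set $S$ is uniformly recurrent if it is (nonempty) factorial and right-extendable and for every $u\in S$ there is $n\ge 1$ such that $u$ is a factor of every word of $S$ of length $n$. Tree sets. For a factorial set $S$ and $w\in S$, let $L(w)=\{a\in A\mid aw\in S\}$, $R(w)=\{a\in A\mid wa\in S\}$, $E(w)=\{(a,b)\in A\times A\mid awb\in S\}$. The extension graph $G(w)$ is the undirected graph whose vertex set is the disjoint union of $L(w)$ and $R(w)$ and whose edges are the pairs $(a,b)\in E(w)$ (joining $a\in L(w)$ to $b\in R(w)$). $S$ is a tree set if it is factorial, biextendable, and for every $w\in S$ (including the empty word) the graph $G(w)$ is a tree, i.e. connected and acyclic. Codes. A prefix code is a set of nonempty words containing no proper prefix of any of its elements; a suffix code is defined symmetrically; a bifix code is both a prefix code and a suffix code. A bifix code $Z\subset S$ is $S$-maximal if it is not properly contained in any bifix code $Z'\subset S$.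 A coding morphism for a code $Z\subset A^+$ is a monoid morphism $f:B^*\to A^*$ which maps the alphabet $B$ bijectively onto $Z$. If $f$ is a coding morphism for a finite $S$-maximal bifix code, $f^{-1}(S)$ is called a maximal bifix decoding of $S$. *)

theory Defs
  imports "HOL-Library.Sublist" "Graph_Theory.Digraph_Component"
begin

text \<open>
  Words over an alphabet \<open>A :: 'a set\<close> are the elements of \<open>lists A\<close>. The library relation
  \<^const>\<open>sublist\<close> is the relation of being a (contiguous) factor.
\<close>

definition factorial :: "'a list set \<Rightarrow> bool" where
  "factorial S \<longleftrightarrow> (\<forall>w\<in>S. \<forall>u. sublist u w \<longrightarrow> u \<in> S)"

definition right_extendable :: "'a set \<Rightarrow> 'a list set \<Rightarrow> bool" where
  "right_extendable A S \<longleftrightarrow> (\<forall>w\<in>S. \<exists>a\<in>A. w @ [a] \<in> S)"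

definition biextendable :: "'a set \<Rightarrow> 'a list set \<Rightarrow> bool" where
  "biextendable A S \<longleftrightarrow> (\<forall>w\<in>S. \<exists>a\<in>A. \<exists>b\<in>A. [a] @ w @ [b] \<in> S)"

definition uniformly_recurrent :: "'a set \<Rightarrow> 'a list set \<Rightarrow> bool" where
  "uniformly_recurrent A S \<longleftrightarrow>
     S \<subseteq> lists A \<and> S \<noteq> {} \<and> factorial S \<and> right_extendable A S \<and>
     (\<forall>u\<in>S. \<exists>n\<ge>1. \<forall>w\<in>S. length w = n \<longrightarrow> sublist u w)"

definition left_letters :: "'a set \<Rightarrow> 'a list set \<Rightarrow> 'a list \<Rightarrow> 'a set" where
  "left_letters A S w = {a \<in> A. [a] @ w \<in> S}"

definition right_letters :: "'a set \<Rightarrow> 'a list set \<Rightarrow> 'a list \<Rightarrow> 'a set" where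
  "right_letters A S w = {a \<in> A. w @ [a] \<in> S}"

definition two_sided_extensions :: "'a set \<Rightarrow> 'a list set \<Rightarrow> 'a list \<Rightarrow> ('a \<times> 'a) set" where
  "two_sided_extensions A S w = {(a, b) \<in> A \<times> A. [a] @ w @ [b] \<in> S}"

text \<open>
  As usual in \<open>Graph_Theory\<close>, an undirected graph is a symmetric digraph: every undirected edge is
  represented by the two opposite arcs. The sum type makes the two vertex sets disjoint.
\<close>

definition extension_graph ::
  "'a set \<Rightarrow> 'a list set \<Rightarrow> 'a list \<Rightarrow> ('a + 'a, ('a + 'a) \<times> ('a + 'a)) pre_digraph" where
  "extension_graph A S w =
     \<lparr> verts = Inl ` left_letters A S w \<union> Inr ` right_letters A S w,
       arcs = {(Inl a, Inr b) | a b. (a, b) \<in> two_sided_extensions A S w} \<union>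
              {(Inr b, Inl a) | a b. (a, b) \<in> two_sided_extensions A S w},
       tail = fst, head = snd \<rparr>"

text \<open>
  The library predicate \<^const>\<open>tree\<close> excludes all directed cycles, hence every symmetric digraph
  with an edge, because going forth and back along an edge is a directed cycle of length 2. In a
  symmetric digraph without loops and parallel arcs, the cycles of the underlying undirected graph
  are exactly the directed cycles of length at least 3.
\<close>

definition undirected_tree :: "('v, 'e) pre_digraph \<Rightarrow> bool" where
  "undirected_tree G \<longleftrightarrow>
     Digraph_Component.connected G \<and> \<not> (\<exists>p. pre_digraph.cycle G p \<and> 3 \<le> length p)"

definition tree_set :: "'a set \<Rightarrow> 'a list set \<Rightarrow> bool" where
  "tree_set A S \<longleftrightarrow>
     S \<subseteq> lists A \<and> factorial S \<and> biextendable A S \<and>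
     (\<forall>w\<in>S. undirected_tree (extension_graph A S w))"

lemma graph_extension_graph:
  assumes "finite A" "factorial S"
  shows "graph (extension_graph A S w)"
proof -
  have closed: "a # w \<in> S" "w @ [b] \<in> S" if "a # w @ [b] \<in> S" for a b
    using assms(2) that unfolding factorial_def
    by (metis append_Cons prefix_imp_sublist prefixI,
        metis suffix_imp_sublist suffix_ConsI suffix_order.refl)
  have fin: "finite (left_letters A S w)" "finite (right_letters A S w)"
    using assms(1) by (auto simp: left_letters_def right_letters_def)
  have sub: "arcs (extension_graph A S w)
      \<subseteq> verts (extension_graph A S w) \<times> verts (extension_graph A S w)"
    by (auto simp: extension_graph_def two_sided_extensions_def left_letters_def
        right_letters_def closed)
  have finv: "finite (verts (extension_graph A S w))"
    using fin by (simp add: extension_graph_def)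
  have fina: "finite (arcs (extension_graph A S w))"
    using finite_subset[OF sub] finv by blast
  have th: "tail (extension_graph A S w) = fst" "head (extension_graph A S w) = snd"
    by (simp_all add: extension_graph_def)
  have noloop: "fst e \<noteq> snd e" if "e \<in> arcs (extension_graph A S w)" for e
    using that by (auto simp: extension_graph_def)
  have sym: "(y, x) \<in> arcs (extension_graph A S w)"
    if "(x, y) \<in> arcs (extension_graph A S w)" for x y
    using that by (auto simp: extension_graph_def)
  have "symmetric (extension_graph A S w)"
    unfolding symmetric_conv th by (metis sym fst_conv snd_conv prod.collapse)
  then show ?thesis
    using finv fina sub noloop
    by unfold_locales (auto simp: th arc_to_ends_def prod_eq_iff)
qed

definition prefix_code :: "'a list set \<Rightarrow> bool" where
  "prefix_code Z \<longleftrightarrow> [] \<notin> Z \<and> (\<forall>x\<in>Z. \<forall>p. strict_prefix p x \<longrightarrow> p \<notin> Z)"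

definition suffix_code :: "'a list set \<Rightarrow> bool" where
  "suffix_code Z \<longleftrightarrow> [] \<notin> Z \<and> (\<forall>x\<in>Z. \<forall>s. strict_suffix s x \<longrightarrow> s \<notin> Z)"

definition bifix_code :: "'a list set \<Rightarrow> bool" where
  "bifix_code Z \<longleftrightarrow> prefix_code Z \<and> suffix_code Z"

definition maximal_bifix_code :: "'a list set \<Rightarrow> 'a list set \<Rightarrow> bool" where
  "maximal_bifix_code S Z \<longleftrightarrow>
     bifix_code Z \<and> Z \<subseteq> S \<and> \<not> (\<exists>Z'. bifix_code Z' \<and> Z' \<subseteq> S \<and> Z \<subset> Z')"

definition word_morphism :: "'b set \<Rightarrow> 'a set \<Rightarrow> ('b list \<Rightarrow> 'a list) \<Rightarrow> bool" where
  "word_morphism B A f \<longleftrightarrow>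
     f ` lists B \<subseteq> lists A \<and> f [] = [] \<and>
     (\<forall>u\<in>lists B. \<forall>v\<in>lists B. f (u @ v) = f u @ f v)"

text \<open>
  That \<open>Z\<close> is a code is not part of the following definition; it is a hypothesis on \<open>Z\<close> wherever
  a coding morphism is considered (a bifix code is a code).
\<close>

definition coding_morphism ::
  "'b set \<Rightarrow> 'a set \<Rightarrow> 'a list set \<Rightarrow> ('b list \<Rightarrow> 'a list) \<Rightarrow> bool" where
  "coding_morphism B A Z f \<longleftrightarrow> word_morphism B A f \<and> bij_betw (\<lambda>b. f [b]) B Z"

definition decoding :: "'b set \<Rightarrow> ('b list \<Rightarrow> 'a list) \<Rightarrow> 'a list set \<Rightarrow> 'b list set" where
  "decoding B f S = {w \<in> lists B. f w \<in> S}"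

end

theory Submission
  imports Defs
begin

text \<open>
  Completeness of \<open>Z\<close> (every long word of \<open>S\<close> has a prefix and a suffix in \<open>Z\<close>) follows by
  counting parses. The extension graph of \<open>w\<close> in the decoding is the graph of the extensions of
  \<open>f w\<close> by words of \<open>Z\<close> on both sides; it is obtained from the extension graphs of \<open>S\<close> by
  repeatedly replacing a vertex by a tree on its neighbours, so it is a tree.

  For uniform recurrence, let \<open>L\<close> be a nonempty factorial and biextendable subset of the decoding
  \<open>T\<close>. As \<open>S\<close> is uniformly recurrent and a fixed word has finitely many cut positions, all
  extensions in \<open>T\<close> of a sufficiently long word of \<open>L\<close> remain in \<open>L\<close>. Connectedness of the
  extension graphs of \<open>T\<close> passes this property down to shorter and shorter words, whence
  \<open>L = T\<close>. If \<open>T\<close> were not uniformly recurrent, the words that extend arbitrarily far on both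
  sides while avoiding some fixed word would be a proper such subset.
\<close>

subsection \<open>Trees and vertex colourings\<close>

text \<open>Over the field with two elements this says that the coboundary of \<open>K\<close>
  agrees with \<open>C\<close> on the edges in \<open>r\<close>. For \<open>C = {}\<close> it says
  that \<open>K\<close> is constant along edges.\<close>

definition separating :: "('v \<times> 'v) set \<Rightarrow> ('v \<times> 'v) set \<Rightarrow> ('v \<Rightarrow> bool) \<Rightarrow> bool" where
  "separating r C K \<longleftrightarrow> (\<forall>(x, y)\<in>r. (x, y) \<in> C \<longleftrightarrow> K x \<noteq> K y)"

text \<open>The starting vertex is listed only once; the last conjunct closes the cycle. The length
  bound rules out going forth and back along one edge.\<close>

definition vertex_cycle :: "('v \<times> 'v) set \<Rightarrow> 'v list \<Rightarrow> bool" where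
  "vertex_cycle r vs \<longleftrightarrow> distinct vs \<and> 3 \<le> length vs \<and>
     successively (\<lambda>x y. (x, y) \<in> r) vs \<and> (last vs, hd vs) \<in> r"

lemma rtrancl_distinct_path:
  assumes "(x, y) \<in> r\<^sup>*"
  shows "\<exists>vs. vs \<noteq> [] \<and> hd vs = x \<and> last vs = y \<and> distinct vs \<and>
    successively (\<lambda>x y. (x, y) \<in> r) vs"
  using assms
proof (induction rule: rtrancl_induct)
  case base
  show ?case by (rule exI[of _ "[x]"]) simp
next
  case (step y z)
  then obtain vs where vs: "vs \<noteq> []" "hd vs = x" "last vs = y" "distinct vs"
    "successively (\<lambda>x y. (x, y) \<in> r) vs" by blast
  show ?case
  proof (cases "z \<in> set vs")
    case True
    \<comment> \<open>The path has already visited \<open>z\<close>, so it is cut off there.\<close>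
    then obtain ps qs where "vs = ps @ z # qs" by (meson split_list)
    with vs have "hd (ps @ [z]) = x \<and> distinct (ps @ [z]) \<and>
        successively (\<lambda>x y. (x, y) \<in> r) (ps @ [z])"
      by (auto simp: successively_append_iff hd_append)
    then show ?thesis by (intro exI[of _ "ps @ [z]"]) simp
  next
    case False
    with vs step.hyps show ?thesis
      by (intro exI[of _ "vs @ [z]"]) (auto simp: successively_append_iff)
  qed
qed

text \<open>Induction on the number of arcs. Deleting an edge of an acyclic graph puts its ends into
  different components, so a colouring of the rest can be corrected on the deleted edge by flipping
  one component.\<close>

lemma separating_if_no_vertex_cycle:
  assumes "finite r" "sym r" "irrefl r" "sym C" "\<nexists>vs. vertex_cycle r vs"
  shows "\<exists>K. separating r C K"
  using assms
proof (induction "card r" arbitrary: r rule: less_induct)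
  case less
  show ?case
  proof (cases "r = {}")
    case True
    then show ?thesis by (intro exI[of _ "\<lambda>_. True"]) (simp add: separating_def)
  next
    case False
    then obtain a b where ab: "(a, b) \<in> r" by auto
    define r' where "r' = r - {(a, b), (b, a)}"
    have "r' \<subset> r" using ab by (auto simp: r'_def)
    then have lt: "card r' < card r" using less.prems(1) by (simp add: psubset_card_mono)
    have sub: "r' \<subseteq> r" by (auto simp: r'_def)
    have sym': "sym r'" using less.prems(2) by (auto simp: r'_def sym_def)
    have irr': "irrefl r'" using less.prems(3) by (auto simp: r'_def irrefl_def)
    have mono: "successively (\<lambda>x y. (x, y) \<in> r) vs" if "successively (\<lambda>x y. (x, y) \<in> r') vs" for vs
      using that by (rule successively_mono) (use sub in blast)
    have nocyc: "\<nexists>vs. vertex_cycle r' vs"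
    proof
      assume "\<exists>vs. vertex_cycle r' vs"
      then obtain vs where "vertex_cycle r' vs" by (rule exE)
      then have "vertex_cycle r vs" unfolding vertex_cycle_def using mono sub by blast
      then show False using less.prems(5) by blast
    qed
    obtain K where K: "separating r' C K"
      using less.hyps[OF lt finite_subset[OF sub less.prems(1)] sym' irr' less.prems(4) nocyc]
      by (rule exE)
    \<comment> \<open>The component of \<open>a\<close> after deletion of the edge.\<close>
    define D where "D = {x. (a, x) \<in> r'\<^sup>*}"
    have "b \<notin> D"
    proof
      assume "b \<in> D"
      then have "(a, b) \<in> r'\<^sup>*" by (simp add: D_def)
      from rtrancl_distinct_path[OF this] obtain vs where vs: "vs \<noteq> []" "hd vs = a" "last vs = b"
        "distinct vs" "successively (\<lambda>x y. (x, y) \<in> r') vs" by blast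
      have "a \<noteq> b" using ab less.prems(3) by (auto simp: irrefl_def)
      moreover from this have "tl vs \<noteq> []" using vs(1-3) by (cases vs) auto
      \<comment> \<open>The path does not use the deleted edge, so it has a third vertex and the
        edge closes it to a cycle.\<close>
      moreover have "vs \<noteq> [a, b]" using vs(5) by (auto simp: r'_def)
      ultimately have "3 \<le> length vs"
        using vs(1-3) by (cases vs rule: remdups_adj.cases) (auto simp: Suc_le_eq)
      moreover have "(b, a) \<in> r" using ab less.prems(2) by (auto simp: sym_def)
      ultimately have "vertex_cycle r vs" using vs mono by (simp add: vertex_cycle_def)
      then show False using less.prems(5) by blast
    qed
    then have D: "a \<in> D" "b \<notin> D" by (simp_all add: D_def)
    have D_iff: "x \<in> D \<longleftrightarrow> y \<in> D" if "(x, y) \<in> r'" for x y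
    proof -
      have "(y, x) \<in> r'" using that sym' by (simp add: sym_def)
      with that show ?thesis by (auto simp: D_def intro: rtrancl_into_rtrancl)
    qed
    \<comment> \<open>Flipping \<open>K\<close> on \<open>D\<close> changes the value on the edge
      between \<open>a\<close> and \<open>b\<close> and on no edge of \<open>r'\<close>.\<close>
    define K' where "K' = (if (a, b) \<in> C \<longleftrightarrow> K a \<noteq> K b then K else (\<lambda>x. K x \<noteq> (x \<in> D)))"
    have ab': "(a, b) \<in> C \<longleftrightarrow> K' a \<noteq> K' b" using D by (simp add: K'_def)
    have ba: "(b, a) \<in> C \<longleftrightarrow> (a, b) \<in> C" using less.prems(4) unfolding sym_def by blast
    have "(x, y) \<in> C \<longleftrightarrow> K' x \<noteq> K' y" if "(x, y) \<in> r" for x y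
    proof (cases "(x, y) \<in> r'")
      case True
      then have "(x, y) \<in> C \<longleftrightarrow> K x \<noteq> K y"
        using bspec[OF K[unfolded separating_def], of "(x, y)"] by simp
      moreover have "K' x \<noteq> K' y \<longleftrightarrow> K x \<noteq> K y"
        using D_iff[OF True] by (cases "y \<in> D") (auto simp: K'_def)
      ultimately show ?thesis by simp
    next
      case False
      then have "(x, y) = (a, b) \<or> (x, y) = (b, a)" using that by (auto simp: r'_def)
      then show ?thesis
      proof
        assume "(x, y) = (a, b)"
        then show ?thesis using ab' by simp
      next
        assume "(x, y) = (b, a)"
        then have "x = b" "y = a" by simp_all
        moreover have "(b, a) \<in> C \<longleftrightarrow> K' b \<noteq> K' a" unfolding ba ab' by blast
        ultimately show ?thesis by simp
      qed
    qed
    then have "separating r C K'" unfolding separating_def by (intro ballI) (simp add: split_paired_all)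
    then show ?thesis by blast
  qed
qed

section \<open>Walks, cycles and connectedness in terms of colourings\<close>

lemma pre_digraph_cas_vertex_path:
  fixes G :: "('v, 'v \<times> 'v) pre_digraph"
  assumes "tail G = fst" "head G = snd" "vs \<noteq> []"
  shows "pre_digraph.cas G (hd vs) (zip vs (tl vs) @ [(last vs, y)]) y"
  using assms(3)
proof (induction vs)
  case (Cons v vs)
  then show ?case by (cases vs) (auto simp: pre_digraph.cas.simps assms)
qed simp

text \<open>The tail of every arc after the first is the head of the arc before it.\<close>

lemma cas_in_head_or_start:
  fixes G :: "('v, 'v \<times> 'v) pre_digraph"
  assumes "tail G = fst" "head G = snd" "pre_digraph.cas G y p u" "(x, z) \<in> set p"
  shows "x = y \<or> x \<in> snd ` set p"
  using assms(3,4) by (induction p arbitrary: y) (auto simp: pre_digraph.cas.simps assms(1,2))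

lemma cas_colour_constant:
  fixes G :: "('v, 'v \<times> 'v) pre_digraph"
  assumes "tail G = fst" "head G = snd" "pre_digraph.cas G y p u"
    and "\<forall>e\<in>set p. K (fst e) = K (snd e)"
  shows "K y = K u"
  using assms(3,4) by (induction p arbitrary: y) (auto simp: pre_digraph.cas.simps assms(1,2))

lemma cas_last:
  fixes G :: "('v, 'v \<times> 'v) pre_digraph"
  assumes "head G = snd" "pre_digraph.cas G y p u" "p \<noteq> []"
  shows "u \<in> snd ` set p"
  using assms(2,3)
proof (induction p arbitrary: y)
  case (Cons e p)
  then show ?case by (cases "p = []") (auto simp: pre_digraph.cas.simps assms(1))
qed simp

lemma awalk_verts_heads:
  fixes G :: "('v, 'v \<times> 'v) pre_digraph"
  assumes "head G = snd" "pre_digraph.cas G u p v"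
  shows "pre_digraph.awalk_verts G u p = u # map snd p"
  using assms(2)
  by (induction p arbitrary: u) (auto simp: pre_digraph.cas.simps pre_digraph.awalk_verts.simps assms(1))

text \<open>The vertices of a walk are its start followed by the heads of its arcs, so distinctness
  in a cycle is distinctness of the heads.\<close>

lemma cycle_iff_cas:
  fixes G :: "('v, 'v \<times> 'v) pre_digraph"
  assumes "head G = snd"
  shows "pre_digraph.cycle G p \<longleftrightarrow> (\<exists>u\<in>verts G. set p \<subseteq> arcs G \<and> pre_digraph.cas G u p u \<and>
    distinct (map snd p) \<and> p \<noteq> [])"
proof -
  have "tl (pre_digraph.awalk_verts G u p) = map snd p" if "pre_digraph.cas G u p u" for u
    using awalk_verts_heads[OF assms that] by simp
  then show ?thesis unfolding pre_digraph.cycle_def pre_digraph.awalk_def by auto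
qed

lemma vertex_cycle_imp_cycle:
  fixes G :: "('v, 'v \<times> 'v) pre_digraph"
  assumes G: "tail G = fst" "head G = snd" "arcs G \<subseteq> verts G \<times> verts G"
    and vs: "vertex_cycle (arcs G) vs"
  shows "\<exists>p. pre_digraph.cycle G p \<and> 3 \<le> length p"
proof -
  let ?p = "zip vs (tl vs) @ [(last vs, hd vs)]"
  from vs have ne: "vs \<noteq> []" by (auto simp: vertex_cycle_def)
  have "set (zip vs (tl vs)) \<subseteq> arcs G"
    using vs unfolding vertex_cycle_def successively_conv_nth
    by (auto simp: set_zip nth_tl)
  then have arcs: "set ?p \<subseteq> arcs G" using vs by (auto simp: vertex_cycle_def)
  have len: "length (tl vs) \<le> length vs" by simp
  have "map snd ?p = tl vs @ [hd vs]" by (simp add: map_snd_zip_take)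
  moreover have "distinct (tl vs @ [hd vs])"
    using vs ne by (cases vs) (auto simp: vertex_cycle_def)
  moreover have "pre_digraph.cas G (hd vs) ?p (hd vs)"
    using pre_digraph_cas_vertex_path[OF G(1,2) ne] .
  moreover have "hd vs \<in> verts G" using arcs G(3) by auto
  ultimately have "pre_digraph.cycle G ?p"
    using arcs unfolding cycle_iff_cas[OF G(2)] by (metis append_is_Nil_conv list.distinct(1))
  moreover have "3 \<le> length ?p" using vs by (auto simp: vertex_cycle_def)
  ultimately show ?thesis by blast
qed

text \<open>Take for \<open>C\<close> the first edge of the cycle alone. The colour must change
  along that edge and stay the same along the rest of the cycle, which leads back to the
  start.\<close>

lemma no_long_cycle_if_separating:
  fixes G :: "('v, 'v \<times> 'v) pre_digraph"
  assumes G: "tail G = fst" "head G = snd"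
    and sep: "\<And>C. sym C \<Longrightarrow> \<exists>K. separating (arcs G) C K"
    and p: "pre_digraph.cycle G p" "3 \<le> length p"
  shows False
proof -
  obtain u where u: "set p \<subseteq> arcs G" "pre_digraph.cas G u p u" "distinct (map snd p)"
    using p(1) unfolding cycle_iff_cas[OF G(2)] by blast
  obtain e1 e2 q where pq: "p = e1 # e2 # q" "q \<noteq> []"
    using p(2) by (cases p; cases "tl p"; cases "tl (tl p)") auto
  define x y where "x = snd e1" and "y = snd e2"
  have e: "e1 = (u, x)" "e2 = (x, y)" and q: "pre_digraph.cas G y q u"
    using u(2) unfolding pq x_def y_def
    by (auto simp: pre_digraph.cas.simps G prod_eq_iff)
  have d: "x \<noteq> y" "x \<notin> snd ` set q" "y \<notin> snd ` set q" using u(3) by (auto simp: pq e)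
  have "u \<in> snd ` set q" using cas_last[OF G(2) q pq(2)] .
  then have "y \<noteq> u" using d by auto
  define C where "C = {(u, x), (x, u)}"
  then obtain K where K: "separating (arcs G) C K" using sep[of C] by (auto simp: sym_def)
  \<comment> \<open>An arc of \<open>q\<close> from \<open>x\<close> would need \<open>x\<close> as
    its first vertex or as a head, and an arc into \<open>x\<close> would repeat a head. So the rest
    of the cycle does not use the first edge in either direction.\<close>
  have "(x, u) \<notin> set q" using cas_in_head_or_start[OF G q] d by blast
  moreover have "(u, x) \<notin> set q" using d by force
  ultimately have "\<forall>e\<in>set (e2 # q). e \<notin> C" using \<open>y \<noteq> u\<close> d by (auto simp: C_def e)
  moreover have "\<forall>e\<in>set (e2 # q). e \<in> arcs G" using u(1) by (auto simp: pq)
  moreover have "e \<in> C \<longleftrightarrow> K (fst e) \<noteq> K (snd e)" if "e \<in> arcs G" for e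
    using bspec[OF K[unfolded separating_def] that] by (simp add: case_prod_beta)
  ultimately have "\<forall>e\<in>set (e2 # q). K (fst e) = K (snd e)" by blast
  moreover have "pre_digraph.cas G x (e2 # q) u" using q by (simp add: pre_digraph.cas.simps G e)
  ultimately have "K x = K u" using cas_colour_constant[OF G] by blast
  moreover have "K u \<noteq> K x" using K u(1) unfolding separating_def pq e C_def by auto
  ultimately show False by simp
qed

text \<open>For the converse direction, reachability from a fixed vertex is a colouring that is
  constant along edges, hence constant.\<close>

lemma connected_iff_colouring_constant:
  fixes G :: "('v, 'v \<times> 'v) pre_digraph"
  assumes G: "tail G = fst" "head G = snd" "arcs G \<subseteq> verts G \<times> verts G" "sym (arcs G)"
  shows "Digraph_Component.connected G \<longleftrightarrow> verts G \<noteq> {} \<and>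
    (\<forall>K. separating (arcs G) {} K \<longrightarrow> (\<exists>c::bool. \<forall>x\<in>verts G. K x = c))"
proof -
  have parcs: "parcs (mk_symmetric G) = arcs G"
    using G(4) by (auto simp: parcs_mk_symmetric G sym_def)
  have conn: "Digraph_Component.connected G \<longleftrightarrow> verts G \<noteq> {} \<and>
      (\<forall>u\<in>verts G. \<forall>v\<in>verts G. (u, v) \<in> rtrancl_on (verts G) (arcs G))"
    unfolding Digraph_Component.connected_def strongly_connected_def reachable_def
    by (simp add: parcs)
  have const: "K u = K v"
    if "separating (arcs G) {} K" "(u, v) \<in> rtrancl_on (verts G) (arcs G)" for K u v
    using that(2,1) by (induction rule: rtrancl_on_induct) (auto simp: separating_def)
  show ?thesis
  proof
    assume "Digraph_Component.connected G"
    with conn const show "verts G \<noteq> {} \<and>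
        (\<forall>K. separating (arcs G) {} K \<longrightarrow> (\<exists>c::bool. \<forall>x\<in>verts G. K x = c))"
      by metis
  next
    assume R: "verts G \<noteq> {} \<and>
        (\<forall>K. separating (arcs G) {} K \<longrightarrow> (\<exists>c::bool. \<forall>x\<in>verts G. K x = c))"
    have "(u, v) \<in> rtrancl_on (verts G) (arcs G)" if "u \<in> verts G" "v \<in> verts G" for u v
    proof -
      let ?K = "\<lambda>x. (u, x) \<in> rtrancl_on (verts G) (arcs G)"
      have "separating (arcs G) {} ?K"
        using G(3,4) unfolding separating_def
        by (auto simp: sym_def intro: rtrancl_on_into_rtrancl_on)
      then obtain c where "\<forall>x\<in>verts G. ?K x = c" using R by blast
      moreover have "?K u" using that by auto
      ultimately show ?thesis using that by blast
    qed
    with R conn show "Digraph_Component.connected G" by blast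
  qed
qed

text \<open>Connectedness is the condition on the kernel of the coboundary map, absence of cycles is
  its surjectivity.\<close>

lemma undirected_tree_iff:
  fixes G :: "('v, 'v \<times> 'v) pre_digraph"
  assumes "graph G" and G: "tail G = fst" "head G = snd"
  shows "undirected_tree G \<longleftrightarrow> verts G \<noteq> {} \<and>
    (\<forall>K. separating (arcs G) {} K \<longrightarrow> (\<exists>c::bool. \<forall>x\<in>verts G. K x = c)) \<and>
    (\<forall>C. sym C \<longrightarrow> (\<exists>K. separating (arcs G) C K))"
proof -
  interpret graph G by fact
  have sub: "arcs G \<subseteq> verts G \<times> verts G"
    using tail_in_verts head_in_verts by (auto simp: G)
  have ae: "arcs_ends G = arcs G" by (auto simp: arcs_ends_def arc_to_ends_def G)
  have sym: "sym (arcs G)" using sym_arcs by (simp add: symmetric_def ae)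
  have "(a, a) \<notin> arcs G" for a using no_loops[of "(a, a)"] by (auto simp: G)
  then have irr: "irrefl (arcs G)" by (simp add: irrefl_def)
  have "\<not> (\<exists>p. pre_digraph.cycle G p \<and> 3 \<le> length p) \<longleftrightarrow>
      (\<forall>C. sym C \<longrightarrow> (\<exists>K. separating (arcs G) C K))" (is "?acyclic \<longleftrightarrow> ?separable")
  proof
    assume ?acyclic
    then have "\<nexists>vs. vertex_cycle (arcs G) vs" using vertex_cycle_imp_cycle[OF G sub] by blast
    then show ?separable
      using separating_if_no_vertex_cycle[OF finite_arcs sym irr] by blast
  next
    assume ?separable
    then show ?acyclic using no_long_cycle_if_separating[OF G] by blast
  qed
  then show ?thesis
    unfolding undirected_tree_def connected_iff_colouring_constant[OF G sub sym] by blast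
qed

section \<open>Bipartite trees and substitution of trees for vertices\<close>

text \<open>
  A bipartite graph is a tree iff over the field with two elements the coboundary map from
  vertex colourings to sets of edges is onto, with kernel the constant colourings.
\<close>

definition bipartite_tree :: "'l set \<Rightarrow> 'r set \<Rightarrow> ('l \<Rightarrow> 'r \<Rightarrow> bool) \<Rightarrow> bool" where
  "bipartite_tree L R E \<longleftrightarrow>
     (\<forall>P Q. (\<forall>a\<in>L. \<forall>b\<in>R. E a b \<longrightarrow> P a = Q b) \<longrightarrow>
       (\<exists>c::bool. (\<forall>a\<in>L. P a = c) \<and> (\<forall>b\<in>R. Q b = c))) \<and>
     (\<forall>C. \<exists>P Q. \<forall>a\<in>L. \<forall>b\<in>R. E a b \<longrightarrow> (C a b \<longleftrightarrow> P a \<noteq> (Q b :: bool)))"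

lemma bipartite_treeD:
  fixes P :: "'l \<Rightarrow> bool" and Q :: "'r \<Rightarrow> bool"
  assumes "bipartite_tree L R E" "\<And>a b. a \<in> L \<Longrightarrow> b \<in> R \<Longrightarrow> E a b \<Longrightarrow> P a = Q b"
  obtains c where "\<And>a. a \<in> L \<Longrightarrow> P a = c" "\<And>b. b \<in> R \<Longrightarrow> Q b = c"
proof -
  from assms(1) have "\<forall>P Q. (\<forall>a\<in>L. \<forall>b\<in>R. E a b \<longrightarrow> P a = Q b) \<longrightarrow>
      (\<exists>c::bool. (\<forall>a\<in>L. P a = c) \<and> (\<forall>b\<in>R. Q b = c))"
    unfolding bipartite_tree_def by (rule conjunct1)
  from this[THEN spec, of P, THEN spec, of Q] assms(2)
  obtain c where "(\<forall>a\<in>L. P a = c) \<and> (\<forall>b\<in>R. Q b = c)" by auto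
  then show ?thesis by (intro that) auto
qed

lemma bipartite_tree_separate:
  assumes "bipartite_tree L R E"
  obtains P Q where
    "\<And>a b. a \<in> L \<Longrightarrow> b \<in> R \<Longrightarrow> E a b \<Longrightarrow> C a b \<longleftrightarrow> P a \<noteq> (Q b :: bool)"
proof -
  from assms have "\<forall>C. \<exists>P Q. \<forall>a\<in>L. \<forall>b\<in>R. E a b \<longrightarrow> (C a b \<longleftrightarrow> P a \<noteq> (Q b :: bool))"
    unfolding bipartite_tree_def by (rule conjunct2)
  from this[THEN spec, of C] obtain P Q
    where "\<forall>a\<in>L. \<forall>b\<in>R. E a b \<longrightarrow> (C a b \<longleftrightarrow> P a \<noteq> (Q b :: bool))" by (elim exE)
  then show ?thesis by (intro that) auto
qed

lemma bipartite_treeI: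
  assumes "\<And>P Q. (\<And>a b. a \<in> L \<Longrightarrow> b \<in> R \<Longrightarrow> E a b \<Longrightarrow> P a = Q b) \<Longrightarrow>
      \<exists>c::bool. (\<forall>a\<in>L. P a = c) \<and> (\<forall>b\<in>R. Q b = c)"
    and "\<And>C. \<exists>P Q. \<forall>a\<in>L. \<forall>b\<in>R. E a b \<longrightarrow> (C a b \<longleftrightarrow> P a \<noteq> (Q b :: bool))"
  shows "bipartite_tree L R E"
  unfolding bipartite_tree_def using assms by auto

lemma bipartite_tree_cong:
  assumes "L = L'" "R = R'" "\<And>a b. a \<in> L' \<Longrightarrow> b \<in> R' \<Longrightarrow> E a b = E' a b"
  shows "bipartite_tree L R E \<longleftrightarrow> bipartite_tree L' R' E'"
  using assms by (simp add: bipartite_tree_def)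

lemma bipartite_tree_flip:
  assumes "bipartite_tree L R E"
  shows "bipartite_tree R L (\<lambda>b a. E a b)"
proof (rule bipartite_treeI)
  fix P Q :: "_ \<Rightarrow> bool"
  assume PQ: "\<And>b a. b \<in> R \<Longrightarrow> a \<in> L \<Longrightarrow> E a b \<Longrightarrow> P b = Q a"
  obtain c where "\<And>a. a \<in> L \<Longrightarrow> Q a = c" "\<And>b. b \<in> R \<Longrightarrow> P b = c"
    by (rule bipartite_treeD[OF assms, of Q P]) (use PQ in auto)
  then show "\<exists>c. (\<forall>b\<in>R. P b = c) \<and> (\<forall>a\<in>L. Q a = c)" by auto
next
  fix C
  obtain P Q where PQ: "\<And>a b. a \<in> L \<Longrightarrow> b \<in> R \<Longrightarrow> E a b \<Longrightarrow> C b a \<longleftrightarrow> P a \<noteq> (Q b :: bool)"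
    by (rule bipartite_tree_separate[OF assms, of "\<lambda>a b. C b a"]) blast
  then have "\<forall>b\<in>R. \<forall>a\<in>L. E a b \<longrightarrow> (C b a \<longleftrightarrow> Q b \<noteq> P a)" by auto
  then show "\<exists>P Q. \<forall>b\<in>R. \<forall>a\<in>L. E a b \<longrightarrow> C b a = (P b \<noteq> (Q a :: bool))" by (intro exI)
qed

lemma bipartite_tree_image:
  assumes "bipartite_tree L R (\<lambda>a b. E (g a) (h b))" "inj_on g L" "inj_on h R"
  shows "bipartite_tree (g ` L) (h ` R) E"
proof (rule bipartite_treeI)
  fix P Q :: "_ \<Rightarrow> bool"
  assume PQ: "\<And>a b. a \<in> g ` L \<Longrightarrow> b \<in> h ` R \<Longrightarrow> E a b \<Longrightarrow> P a = Q b"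
  obtain c where "\<And>a. a \<in> L \<Longrightarrow> P (g a) = c" "\<And>b. b \<in> R \<Longrightarrow> Q (h b) = c"
    by (rule bipartite_treeD[OF assms(1), of "\<lambda>a. P (g a)" "\<lambda>b. Q (h b)"]) (use PQ in auto)
  then show "\<exists>c. (\<forall>a\<in>g ` L. P a = c) \<and> (\<forall>b\<in>h ` R. Q b = c)" by auto
next
  fix C
  obtain P Q where PQ: "\<And>a b. a \<in> L \<Longrightarrow> b \<in> R \<Longrightarrow> E (g a) (h b) \<Longrightarrow>
      C (g a) (h b) \<longleftrightarrow> P a \<noteq> (Q b :: bool)"
    by (rule bipartite_tree_separate[OF assms(1), of "\<lambda>a b. C (g a) (h b)"]) blast
  define P' Q' where "P' = P \<circ> the_inv_into L g" and "Q' = Q \<circ> the_inv_into R h"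
  have "\<forall>a\<in>g ` L. \<forall>b\<in>h ` R. E a b \<longrightarrow> C a b = (P' a \<noteq> Q' b)"
    using PQ assms(2,3) by (simp add: P'_def Q'_def the_inv_into_f_f)
  then show "\<exists>P Q. \<forall>a\<in>g ` L. \<forall>b\<in>h ` R. E a b \<longrightarrow> C a b = (P a \<noteq> (Q b :: bool))"
    by (intro exI)
qed

lemma bipartite_tree_inj_images:
  assumes "inj_on g L" "inj_on h R"
  shows "bipartite_tree (g ` L) (h ` R) E \<longleftrightarrow> bipartite_tree L R (\<lambda>a b. E (g a) (h b))"
proof
  let ?g = "the_inv_into L g" and ?h = "the_inv_into R h"
  assume tree: "bipartite_tree (g ` L) (h ` R) E"
  have inv: "g (?g x) = x" "h (?h y) = y" if "x \<in> g ` L" "y \<in> h ` R" for x y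
    using assms that by (simp_all add: f_the_inv_into_f)
  have "bipartite_tree (g ` L) (h ` R) (\<lambda>x y. E (g (?g x)) (h (?h y)))"
    using tree by (rule bipartite_tree_cong[THEN iffD1, rotated -1]) (simp_all add: inv)
  then have "bipartite_tree (?g ` g ` L) (?h ` h ` R) (\<lambda>a b. E (g a) (h b))"
    by (rule bipartite_tree_image) (use assms in \<open>auto intro: inj_on_the_inv_into\<close>)
  moreover have "?g ` g ` L = L" "?h ` h ` R = R"
    using assms by (auto simp: the_inv_into_f_f image_iff)
  ultimately show "bipartite_tree L R (\<lambda>a b. E (g a) (h b))" by simp
qed (rule bipartite_tree_image[OF _ assms])

lemma bipartite_tree_star: "bipartite_tree L {v} (\<lambda>_ _. True)"
  unfolding bipartite_tree_def
proof (intro conjI allI impI)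
  fix C :: "'a \<Rightarrow> 'b \<Rightarrow> bool"
  show "\<exists>P Q. \<forall>a\<in>L. \<forall>b\<in>{v}. True \<longrightarrow> C a b = (P a \<noteq> (Q b :: bool))"
    by (intro exI[of _ "\<lambda>a. C a v"] exI[of _ "\<lambda>_. False"]) simp
qed auto

text \<open>Each right vertex \<open>v\<close> is replaced by a tree on the neighbours of
  \<open>v\<close> and the new vertices with \<open>par y = v\<close>. A colouring constant along
  the new edges is constant on each of these trees, hence induces such a colouring of the old tree.
  To realize a given \<open>C\<close>, it is realized in each small tree, and the old tree is used
  to make the local colourings agree on common left vertices.\<close>

lemma bipartite_tree_subst:
  assumes tree: "bipartite_tree L R E"
    and par: "\<And>y. y \<in> R' \<Longrightarrow> par y \<in> R"
    and edge: "\<And>u y. u \<in> L \<Longrightarrow> y \<in> R' \<Longrightarrow> E' u y \<Longrightarrow> E u (par y)"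
    and sub: "\<And>v. v \<in> R \<Longrightarrow> bipartite_tree {u \<in> L. E u v} {y \<in> R'. par y = v} E'"
  shows "bipartite_tree L R' E'"
proof (rule bipartite_treeI)
  fix P Q :: "_ \<Rightarrow> bool"
  assume PQ: "\<And>a b. a \<in> L \<Longrightarrow> b \<in> R' \<Longrightarrow> E' a b \<Longrightarrow> P a = Q b"
  have "\<forall>v\<in>R. \<exists>c. (\<forall>u\<in>{u \<in> L. E u v}. P u = c) \<and> (\<forall>y\<in>{y \<in> R'. par y = v}. Q y = c)"
  proof
    fix v assume "v \<in> R"
    obtain c where "\<And>u. u \<in> {u \<in> L. E u v} \<Longrightarrow> P u = c" "\<And>y. y \<in> {y \<in> R'. par y = v} \<Longrightarrow> Q y = c"
      by (rule bipartite_treeD[OF sub[OF \<open>v \<in> R\<close>], of P Q]) (use PQ in auto)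
    then show "\<exists>c. (\<forall>u\<in>{u \<in> L. E u v}. P u = c) \<and> (\<forall>y\<in>{y \<in> R'. par y = v}. Q y = c)"
      by (intro exI[of _ c]) auto
  qed
  from bchoice[OF this] obtain c where
      c: "\<And>v u. v \<in> R \<Longrightarrow> u \<in> L \<Longrightarrow> E u v \<Longrightarrow> P u = c v"
      "\<And>v y. v \<in> R \<Longrightarrow> y \<in> R' \<Longrightarrow> par y = v \<Longrightarrow> Q y = c v"
    by auto
  obtain k where k: "\<And>u. u \<in> L \<Longrightarrow> P u = k" "\<And>v. v \<in> R \<Longrightarrow> c v = k"
    by (rule bipartite_treeD[OF tree, of P c]) (use c(1) in auto)
  have "Q y = k" if "y \<in> R'" for y
    using c(2)[OF par[OF that] that refl] k(2)[OF par[OF that]] by simp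
  with k(1) show "\<exists>c. (\<forall>a\<in>L. P a = c) \<and> (\<forall>b\<in>R'. Q b = c)" by auto
next
  fix C
  let ?ok = "\<lambda>v P Q. \<forall>u y. u \<in> L \<longrightarrow> E u v \<longrightarrow> y \<in> R' \<longrightarrow> par y = v \<longrightarrow> E' u y \<longrightarrow>
    (C u y \<longleftrightarrow> P u \<noteq> (Q y :: bool))"
  have "\<forall>v\<in>R. \<exists>PQ. ?ok v (fst PQ) (snd PQ)"
  proof
    fix v assume "v \<in> R"
    obtain P Q where PQ: "\<And>u y. u \<in> {u \<in> L. E u v} \<Longrightarrow> y \<in> {y \<in> R'. par y = v} \<Longrightarrow> E' u y \<Longrightarrow>
        C u y \<longleftrightarrow> P u \<noteq> (Q y :: bool)"
      by (rule bipartite_tree_separate[OF sub[OF \<open>v \<in> R\<close>], of C]) blast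
    then show "\<exists>PQ. ?ok v (fst PQ) (snd PQ)" by (intro exI[of _ "(P, Q)"]) simp
  qed
  from bchoice[OF this] obtain PQ where PQ: "\<forall>v\<in>R. ?ok v (fst (PQ v)) (snd (PQ v))"
    by (rule exE)
  define P' Q' where "P' v = fst (PQ v)" and "Q' v = snd (PQ v)" for v
  have 1: "C u y \<longleftrightarrow> P' v u \<noteq> Q' v y"
    if "v \<in> R" "u \<in> L" "E u v" "y \<in> R'" "par y = v" "E' u y" for v u y
    using bspec[OF PQ that(1)] that by (simp add: P'_def Q'_def)
  \<comment> \<open>The local colours \<open>P' v u\<close> of a left vertex depend on
    \<open>v\<close>. Viewed as an edge set of the old tree they form a coboundary, so adding
    \<open>Q v\<close> to the local colouring at \<open>v\<close> turns all of them into
    \<open>P u\<close>.\<close>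
  obtain P Q where 2: "\<And>u v. u \<in> L \<Longrightarrow> v \<in> R \<Longrightarrow> E u v \<Longrightarrow> P' v u \<longleftrightarrow> P u \<noteq> (Q v :: bool)"
    by (rule bipartite_tree_separate[OF tree, of "\<lambda>u v. P' v u"]) blast
  define Q'' where "Q'' y \<longleftrightarrow> Q' (par y) y \<noteq> Q (par y)" for y
  have "C u y = (P u \<noteq> Q'' y)" if "u \<in> L" "y \<in> R'" "E' u y" for u y
  proof -
    note R = par[OF that(2)] and e = edge[OF that]
    show ?thesis using 1[OF R that(1) e that(2) refl that(3)] 2[OF that(1) R e]
      unfolding Q''_def by argo
  qed
  then show "\<exists>P Q. \<forall>a\<in>L. \<forall>b\<in>R'. E' a b \<longrightarrow> C a b = (P a \<noteq> (Q b :: bool))"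
    by (intro exI[of _ P] exI[of _ Q'']) blast
qed

text \<open>Nonemptiness is stated separately because \<open>bipartite_tree\<close> holds for the
  empty graph, which is not connected in the sense of the library.\<close>

lemma undirected_tree_extension_graph_iff:
  assumes "finite A" "factorial S"
  shows "undirected_tree (extension_graph A S w) \<longleftrightarrow>
    (left_letters A S w \<noteq> {} \<or> right_letters A S w \<noteq> {}) \<and>
    bipartite_tree (left_letters A S w) (right_letters A S w) (\<lambda>a b. [a] @ w @ [b] \<in> S)"
proof -
  let ?G = "extension_graph A S w" and ?L = "left_letters A S w" and ?R = "right_letters A S w"
  let ?E = "\<lambda>a b. [a] @ w @ [b] \<in> S"
  have th: "tail ?G = fst" "head ?G = snd" by (simp_all add: extension_graph_def)
  have verts: "verts ?G = Inl ` ?L \<union> Inr ` ?R" by (simp add: extension_graph_def)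
  have closed: "a # w \<in> S" "w @ [b] \<in> S" if "a # w @ [b] \<in> S" for a b
    using assms(2) that unfolding factorial_def
    by (metis append_Cons prefix_imp_sublist prefixI,
        metis suffix_imp_sublist suffix_ConsI suffix_order.refl)
  have arcs: "arcs ?G = (\<Union>a\<in>?L. \<Union>b\<in>{b \<in> ?R. ?E a b}. {(Inl a, Inr b), (Inr b, Inl a)})"
    by (auto simp: extension_graph_def two_sided_extensions_def left_letters_def
        right_letters_def closed)
  have sep: "separating (arcs ?G) C K \<longleftrightarrow> (\<forall>a\<in>?L. \<forall>b\<in>?R. ?E a b \<longrightarrow>
      ((Inl a, Inr b) \<in> C \<longleftrightarrow> K (Inl a) \<noteq> K (Inr b)))"
    if "sym C" for C :: "(('a + 'a) \<times> ('a + 'a)) set" and K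
  proof -
    have "(Inr b, Inl a) \<in> C \<longleftrightarrow> (Inl a, Inr b) \<in> C" for a b
      using that unfolding sym_def by blast
    then show ?thesis unfolding arcs separating_def by auto
  qed
  have conn: "(\<forall>K. separating (arcs ?G) {} K \<longrightarrow> (\<exists>c::bool. \<forall>x\<in>verts ?G. K x = c)) \<longleftrightarrow>
      (\<forall>P Q. (\<forall>a\<in>?L. \<forall>b\<in>?R. ?E a b \<longrightarrow> P a = Q b) \<longrightarrow>
       (\<exists>c::bool. (\<forall>a\<in>?L. P a = c) \<and> (\<forall>b\<in>?R. Q b = c)))" (is "(\<forall>K. ?A K) = (\<forall>P Q. ?B P Q)")
  proof (intro iffI allI)
    fix P Q :: "_ \<Rightarrow> bool"
    assume "\<forall>K. ?A K"
    then have "?A (case_sum P Q)" by (elim allE)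
    then show "?B P Q" by (simp add: sep sym_def verts ball_Un)
  next
    fix K
    assume "\<forall>P Q. ?B P Q"
    then have "?B (K \<circ> Inl) (K \<circ> Inr)" by (elim allE)
    then show "?A K" by (simp add: sep sym_def verts ball_Un)
  qed
  have acyc: "(\<forall>C. sym C \<longrightarrow> (\<exists>K. separating (arcs ?G) C K)) \<longleftrightarrow>
      (\<forall>C. \<exists>P Q. \<forall>a\<in>?L. \<forall>b\<in>?R. ?E a b \<longrightarrow> (C a b \<longleftrightarrow> P a \<noteq> (Q b :: bool)))"
    (is "(\<forall>C. ?A C) = (\<forall>C. \<exists>P Q. ?B C P Q)")
  proof (intro iffI allI)
    fix C :: "'a \<Rightarrow> 'a \<Rightarrow> bool"
    \<comment> \<open>Each undirected edge is a pair of opposite arcs, so \<open>C\<close> is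
      symmetrized.\<close>
    let ?C = "{(Inl a, Inr b) | a b. C a b} \<union> {(Inr b, Inl a) | a b. C a b}"
    assume "\<forall>C. ?A C"
    moreover have "sym ?C" by (auto simp: sym_def)
    ultimately obtain K where "separating (arcs ?G) ?C K" by blast
    then have "?B C (K \<circ> Inl) (K \<circ> Inr)" by (simp add: sep[OF \<open>sym ?C\<close>])
    then show "\<exists>P Q. ?B C P Q" by (intro exI)
  next
    fix C :: "(('a + 'a) \<times> ('a + 'a)) set"
    assume "\<forall>C. \<exists>P Q. ?B C P Q"
    then obtain P Q where "?B (\<lambda>a b. (Inl a, Inr b) \<in> C) P Q" by (elim allE exE)
    then have "separating (arcs ?G) C (case_sum P Q)" if "sym C"
      by (simp add: sep[OF that])
    then show "?A C" by blast
  qed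
  show ?thesis
    unfolding undirected_tree_iff[OF graph_extension_graph[OF assms] th] conn acyc
      bipartite_tree_def by (auto simp: verts)
qed

subsection \<open>Completeness of maximal bifix codes\<close>

lemma factorialD:
  assumes "factorial S" "p @ u @ q \<in> S"
  shows "u \<in> S"
  using assms unfolding factorial_def sublist_def by blast

lemma factorial_prefixD: "factorial S \<Longrightarrow> u @ q \<in> S \<Longrightarrow> u \<in> S"
  using factorialD[of S "[]" u q] by simp

lemma factorial_suffixD: "factorial S \<Longrightarrow> p @ u \<in> S \<Longrightarrow> u \<in> S"
  using factorialD[of S p u "[]"] by simp

lemma mem_rev_image_iff: "x \<in> rev ` S \<longleftrightarrow> rev x \<in> S"
  by (metis image_iff rev_rev_ident)

lemma biextendable_long:
  assumes "biextendable A S" "w \<in> S"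
  shows "\<exists>l r. length l = n \<and> length r = n \<and> l @ w @ r \<in> S"
proof (induction n)
  case 0
  then show ?case using assms(2) by simp
next
  case (Suc n)
  then obtain l r where lr: "length l = n" "length r = n" "l @ w @ r \<in> S" by blast
  then obtain a b where "[a] @ (l @ w @ r) @ [b] \<in> S"
    using assms(1) unfolding biextendable_def by blast
  then show ?case using lr by (intro exI[of _ "a # l"] exI[of _ "r @ [b]"]) simp
qed

text \<open>The form in which uniform recurrence enters the completeness argument. It is invariant
  under reversal, so prefixes and suffixes can be exchanged.\<close>

definition irreducible_language :: "'a list set \<Rightarrow> bool" where
  "irreducible_language S \<longleftrightarrow> (\<forall>u\<in>S. \<forall>v\<in>S. \<exists>t. u @ t @ v \<in> S)"

text \<open>Extend \<open>u\<close> to the right by a word of length \<open>n\<close>, where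
  \<open>n\<close> is so large that every word of \<open>S\<close> of this length contains
  \<open>v\<close>.\<close>

lemma uniformly_recurrent_irreducible:
  assumes "uniformly_recurrent A S"
  shows "irreducible_language S"
  unfolding irreducible_language_def
proof (intro ballI)
  fix u v
  assume "u \<in> S" "v \<in> S"
  obtain n where n: "\<And>w. w \<in> S \<Longrightarrow> length w = n \<Longrightarrow> sublist v w"
    using assms \<open>v \<in> S\<close> unfolding uniformly_recurrent_def by blast
  have "\<exists>y. length y = k \<and> u @ y \<in> S" for k
  proof (induction k)
    case 0
    then show ?case using \<open>u \<in> S\<close> by simp
  next
    case (Suc k)
    then obtain y where y: "length y = k" "u @ y \<in> S" by blast
    then obtain a where "(u @ y) @ [a] \<in> S"
      using assms unfolding uniformly_recurrent_def right_extendable_def by blast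
    then show ?case using y by (intro exI[of _ "y @ [a]"]) simp
  qed
  then obtain y where y: "length y = n" "u @ y \<in> S" by blast
  have fac: "factorial S" using assms by (simp add: uniformly_recurrent_def)
  then have "y \<in> S" using y factorial_suffixD by blast
  then obtain t s where "y = t @ v @ s" using n y(1) unfolding sublist_def by blast
  then have "u @ t @ v \<in> S" using y(2) fac factorial_prefixD[of S "u @ t @ v" s] by simp
  then show "\<exists>t. u @ t @ v \<in> S" by blast
qed

lemma irreducible_language_rev: "irreducible_language S \<Longrightarrow> irreducible_language (rev ` S)"
  unfolding irreducible_language_def
proof (intro ballI)
  fix u v
  assume "\<forall>u\<in>S. \<forall>v\<in>S. \<exists>t. u @ t @ v \<in> S" "u \<in> rev ` S" "v \<in> rev ` S"
  then obtain t where "rev v @ t @ rev u \<in> S" by (auto simp: mem_rev_image_iff)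
  then have "u @ rev t @ v \<in> rev ` S" by (simp add: mem_rev_image_iff)
  then show "\<exists>t. u @ t @ v \<in> rev ` S" by blast
qed

lemma factorial_rev: "factorial S \<Longrightarrow> factorial (rev ` S)"
  unfolding factorial_def by (auto simp: mem_rev_image_iff)

lemma prefix_code_rev_iff: "prefix_code (rev ` Z) \<longleftrightarrow> suffix_code Z"
proof -
  have "(\<forall>p. strict_prefix p (rev x) \<longrightarrow> rev p \<notin> Z) \<longleftrightarrow> (\<forall>s. strict_suffix s x \<longrightarrow> s \<notin> Z)" for x
    unfolding strict_suffix_to_prefix by (metis rev_rev_ident)
  then show ?thesis
    unfolding prefix_code_def suffix_code_def by (simp add: mem_rev_image_iff)
qed

lemma bifix_code_rev: "bifix_code Z \<Longrightarrow> bifix_code (rev ` Z)"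
  using prefix_code_rev_iff[of Z] prefix_code_rev_iff[of "rev ` Z"]
  by (simp add: bifix_code_def image_image)

lemma prefix_code_unique:
  assumes "prefix_code Z" "y \<in> Z" "z \<in> Z" "prefix y x" "prefix z x"
  shows "y = z"
  using assms prefix_same_cases[of y x z] unfolding prefix_code_def strict_prefix_def by metis

lemma suffix_code_unique:
  assumes "suffix_code Z" "y \<in> Z" "z \<in> Z" "suffix y x" "suffix z x"
  shows "y = z"
  using assms suffix_same_cases[of y x z] unfolding suffix_code_def strict_suffix_def by metis

section \<open>Counting parses\<close>

text \<open>
  Both sides count the parses of \<open>x\<close>: an occurrence of a word of the code is determined by its
  left end as well as by its right end.
\<close>

lemma card_cuts_without_suffix_eq_prefix:
  assumes "bifix_code Z"
  shows "card {j. j \<le> length x \<and> (\<forall>z\<in>Z. \<not> suffix z (take j x))} =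
    card {i. i \<le> length x \<and> (\<forall>z\<in>Z. \<not> prefix z (drop i x))}"
proof -
  \<comment> \<open>The occurrences of code words in \<open>x\<close>, given by their two ends. The
    sets to be counted are the complements of the two projections of this set, and both projections
    are injective.\<close>
  let ?I = "{(i, j). i \<le> j \<and> j \<le> length x \<and> take (j - i) (drop i x) \<in> Z}"
  have pc: "prefix_code Z" and sc: "suffix_code Z" using assms by (simp_all add: bifix_code_def)
  have fst: "fst ` ?I = {i. i \<le> length x \<and> (\<exists>z\<in>Z. prefix z (drop i x))}"
  proof (intro equalityI subsetI)
    fix i assume "i \<in> {i. i \<le> length x \<and> (\<exists>z\<in>Z. prefix z (drop i x))}"
    then obtain z where z: "i \<le> length x" "z \<in> Z" "prefix z (drop i x)" by blast
    then have "take (length z) (drop i x) = z" "length z \<le> length x - i"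
      using prefix_length_le[OF z(3)] by (auto simp: prefix_def)
    then have "(i, i + length z) \<in> ?I" using z by simp
    then show "i \<in> fst ` ?I" by (rule image_eqI[rotated]) simp
  next
    fix i assume "i \<in> fst ` ?I"
    then obtain j where "i \<le> j" "j \<le> length x" "take (j - i) (drop i x) \<in> Z" by auto
    then show "i \<in> {i. i \<le> length x \<and> (\<exists>z\<in>Z. prefix z (drop i x))}"
      using take_is_prefix by (intro CollectI conjI bexI) auto
  qed
  have snd: "snd ` ?I = {j. j \<le> length x \<and> (\<exists>z\<in>Z. suffix z (take j x))}"
  proof (intro equalityI subsetI)
    fix j assume "j \<in> {j. j \<le> length x \<and> (\<exists>z\<in>Z. suffix z (take j x))}"
    then obtain z y where z: "j \<le> length x" "z \<in> Z" "take j x = y @ z" by (auto simp: suffix_def)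
    have "j = length (take j x)" using z(1) by simp
    then have len: "j = length y + length z" unfolding z(3) by simp
    have "drop (length y) (take j x) = z" unfolding z(3) by simp
    then have "take (j - length y) (drop (length y) x) = z" by (simp only: drop_take)
    then have "(length y, j) \<in> ?I" using z(1,2) len by simp
    then show "j \<in> snd ` ?I" by (rule image_eqI[rotated]) simp
  next
    fix j assume "j \<in> snd ` ?I"
    then obtain i where "i \<le> j" "j \<le> length x" "take (j - i) (drop i x) \<in> Z" by auto
    then show "j \<in> {j. j \<le> length x \<and> (\<exists>z\<in>Z. suffix z (take j x))}"
      using suffix_drop[of i "take j x"] unfolding drop_take by blast
  qed
  have "inj_on fst ?I"
  proof (rule inj_onI, clarsimp)
    fix i j j'
    assume ij: "i \<le> j" "i \<le> j'" "j \<le> length x" "j' \<le> length x"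
      "take (j - i) (drop i x) \<in> Z" "take (j' - i) (drop i x) \<in> Z"
    then have "take (j - i) (drop i x) = take (j' - i) (drop i x)"
      using prefix_code_unique[OF pc] take_is_prefix by blast
    then have "length (take (j - i) (drop i x)) = length (take (j' - i) (drop i x))" by (rule arg_cong)
    with ij show "j = j'" by simp
  qed
  moreover have "inj_on snd ?I"
  proof (rule inj_onI, clarsimp)
    fix i i' j
    assume ij: "i \<le> j" "i' \<le> j" "j \<le> length x"
      "take (j - i) (drop i x) \<in> Z" "take (j - i') (drop i' x) \<in> Z"
    have "take (j - i) (drop i x) = take (j - i') (drop i' x)"
      using suffix_code_unique[OF sc ij(4,5), of "take j x"]
        suffix_drop[of i "take j x"] suffix_drop[of i' "take j x"] unfolding drop_take by blast
    then have "length (take (j - i) (drop i x)) = length (take (j - i') (drop i' x))" by (rule arg_cong)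
    with ij show "i = i'" by simp
  qed
  ultimately have eq: "card (fst ` ?I) = card (snd ` ?I)" by (simp add: card_image)
  have 1: "{j. j \<le> length x \<and> (\<forall>z\<in>Z. \<not> suffix z (take j x))} = {..length x} - snd ` ?I"
    unfolding snd by auto
  have 2: "{i. i \<le> length x \<and> (\<forall>z\<in>Z. \<not> prefix z (drop i x))} = {..length x} - fst ` ?I"
    unfolding fst by auto
  have sub: "snd ` ?I \<subseteq> {..length x}" "fst ` ?I \<subseteq> {..length x}" unfolding fst snd by auto
  show ?thesis unfolding 1 2
    using eq card_Diff_subset[OF finite_subset[OF sub(1)] sub(1)]
      card_Diff_subset[OF finite_subset[OF sub(2)] sub(2)] by simp
qed

text \<open>
  A word \<open>w\<close> without prefix in \<open>Z\<close> starts a new parse at each of its occurrences, but left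
  completeness bounds the number of parses of every word by \<open>m\<close>.
\<close>

lemma prefix_complete_if_suffix_complete:
  assumes fac: "factorial S" and irr: "irreducible_language S" and Z: "bifix_code Z"
    and left: "\<And>y. y \<in> S \<Longrightarrow> m \<le> length y \<Longrightarrow> \<exists>z\<in>Z. suffix z y"
    and bound: "\<And>z. z \<in> Z \<Longrightarrow> length z \<le> m"
    and w: "w \<in> S" "m \<le> length w"
  shows "\<exists>z\<in>Z. prefix z w"
proof (rule ccontr)
  assume no: "\<not> (\<exists>z\<in>Z. prefix z w)"
  define bad where "bad x = {i. i \<le> length x \<and> (\<forall>z\<in>Z. \<not> prefix z (drop i x))}" for x
  have fin: "finite (bad x)" for x
    by (rule finite_subset[of _ "{..length x}"]) (auto simp: bad_def)
  \<comment> \<open>By irreducibility a copy of \<open>w\<close> can be put in front of any word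
    \<open>x\<close> of \<open>S\<close>. The bad positions of \<open>x\<close> are shifted and
    position 0 becomes a new one.\<close>
  have "\<exists>x\<in>S. k \<le> card (bad x)" for k
  proof (induction k)
    case 0
    then show ?case using w by blast
  next
    case (Suc k)
    then obtain x where x: "x \<in> S" "k \<le> card (bad x)" by blast
    then obtain t where t: "w @ t @ x \<in> S"
      using irr w unfolding irreducible_language_def by blast
    have "w \<noteq> []" using left[OF w] no by auto
    let ?n = "length (w @ t)"
    \<comment> \<open>A code word is not longer than \<open>w\<close>, so as a prefix of the whole
      word it would be a prefix of \<open>w\<close>.\<close>
    have "\<not> prefix z (w @ t @ x)" if "z \<in> Z" for z
      using no that bound[OF that] w(2) prefix_length_prefix[of z "w @ t @ x" w] by auto
    then have "0 \<in> bad (w @ t @ x)" by (simp add: bad_def)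
    moreover have "(\<lambda>i. ?n + i) ` bad x \<subseteq> bad (w @ t @ x)"
    proof
      fix k assume "k \<in> (\<lambda>i. ?n + i) ` bad x"
      then obtain i where i: "k = ?n + i" "i \<in> bad x" by blast
      have "drop k (w @ t @ x) = drop i x" unfolding i(1) by simp
      with i show "k \<in> bad (w @ t @ x)" by (simp add: bad_def)
    qed
    moreover have 0: "0 \<notin> (\<lambda>i. ?n + i) ` bad x" using \<open>w \<noteq> []\<close> by auto
    ultimately have "card (insert 0 ((\<lambda>i. ?n + i) ` bad x)) \<le> card (bad (w @ t @ x))"
      by (intro card_mono fin) auto
    moreover have "card (insert 0 ((\<lambda>i. ?n + i) ` bad x)) = Suc (card (bad x))"
      using 0 by (simp add: fin card_image)
    ultimately show ?case using x t by (intro bexI[of _ "w @ t @ x"]) auto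
  qed
  then obtain x where x: "x \<in> S" "Suc m \<le> card (bad x)" by blast
  \<comment> \<open>A prefix of length at least \<open>m\<close> ends in a code word, so at most
    \<open>m\<close> cuts remain, contrary to the choice of \<open>x\<close>.\<close>
  have "{j. j \<le> length x \<and> (\<forall>z\<in>Z. \<not> suffix z (take j x))} \<subseteq> {..<m}"
  proof
    fix j assume j: "j \<in> {j. j \<le> length x \<and> (\<forall>z\<in>Z. \<not> suffix z (take j x))}"
    have "take j x \<in> S" using x(1) factorial_prefixD[OF fac, of "take j x" "drop j x"] by simp
    then have "\<not> m \<le> length (take j x)" using left j by blast
    then show "j \<in> {..<m}" using j by auto
  qed
  from card_mono[OF finite_lessThan this] have "card (bad x) \<le> m"
    unfolding bad_def card_cuts_without_suffix_eq_prefix[OF Z, symmetric] by simp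
  with x(2) show False by simp
qed

lemma suffix_complete_if_prefix_complete:
  assumes fac: "factorial S" and irr: "irreducible_language S" and Z: "bifix_code Z"
    and right: "\<And>y. y \<in> S \<Longrightarrow> m \<le> length y \<Longrightarrow> \<exists>z\<in>Z. prefix z y"
    and bound: "\<And>z. z \<in> Z \<Longrightarrow> length z \<le> m"
    and w: "w \<in> S" "m \<le> length w"
  shows "\<exists>z\<in>Z. suffix z w"
proof -
  have "\<exists>z\<in>rev ` Z. suffix z y" if "y \<in> rev ` S" "m \<le> length y" for y
    using right[of "rev y"] that by (auto simp: mem_rev_image_iff suffix_to_prefix)
  then have "\<exists>z\<in>rev ` Z. prefix z (rev w)"
    using w bound
    by (intro prefix_complete_if_suffix_complete[OF factorial_rev[OF fac]
          irreducible_language_rev[OF irr] bifix_code_rev[OF Z], of m]) auto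
  then show ?thesis by (auto simp: suffix_to_prefix)
qed

text \<open>If both claims failed, a word \<open>w\<close> without prefix in \<open>Z\<close> and a
  word \<open>y\<close> without suffix in \<open>Z\<close> could be joined to
  \<open>w @ t @ y\<close> in \<open>S\<close>. This word is too long to be a proper prefix or
  suffix of a code word, so adding it would enlarge \<open>Z\<close>. Hence one claim holds, and
  parse counting yields the other.\<close>

lemma maximal_bifix_code_complete:
  assumes fac: "factorial S" and irr: "irreducible_language S" and max: "maximal_bifix_code S Z"
    and bound: "\<And>z. z \<in> Z \<Longrightarrow> length z \<le> m" and "0 < m"
  shows "\<And>w. w \<in> S \<Longrightarrow> m \<le> length w \<Longrightarrow> \<exists>z\<in>Z. prefix z w"
    and "\<And>w. w \<in> S \<Longrightarrow> m \<le> length w \<Longrightarrow> \<exists>z\<in>Z. suffix z w"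
proof -
  have Z: "bifix_code Z" using max by (simp add: maximal_bifix_code_def)
  have "(\<forall>w\<in>S. m \<le> length w \<longrightarrow> (\<exists>z\<in>Z. prefix z w)) \<or>
      (\<forall>w\<in>S. m \<le> length w \<longrightarrow> (\<exists>z\<in>Z. suffix z w))"
  proof (rule ccontr)
    assume "\<not> ?thesis"
    then obtain w y where w: "w \<in> S" "m \<le> length w" "\<forall>z\<in>Z. \<not> prefix z w"
      and y: "y \<in> S" "m \<le> length y" "\<forall>z\<in>Z. \<not> suffix z y" by blast
    then obtain t where t: "w @ t @ y \<in> S" using irr unfolding irreducible_language_def by blast
    let ?x = "w @ t @ y"
    have pre: False if "z \<in> Z" "prefix z ?x" for z
      using that bound[of z] w(2,3) prefix_length_prefix[of z ?x w] by simp
    have suf: False if "z \<in> Z" "suffix z ?x" for z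
      using that bound[of z] y(2,3) suffix_length_suffix[of z ?x y] by (simp add: suffix_append)
    have long: False if "z \<in> Z" "length ?x < length z" for z
      using that bound[of z] w(2) by simp
    have "?x \<notin> Z" using pre by blast
    have ne: "[] \<notin> insert ?x Z"
      using Z w(2) \<open>0 < m\<close> by (auto simp: bifix_code_def prefix_code_def)
    have "p \<notin> insert ?x Z" if q: "q \<in> insert ?x Z" "strict_prefix p q" for p q
    proof
      have "p \<noteq> q" using q(2) by auto
      assume "p \<in> insert ?x Z"
      then consider "q = ?x" "p \<in> Z" | "q \<in> Z" "p = ?x" | "q \<in> Z" "p \<in> Z"
        using q \<open>p \<noteq> q\<close> by blast
      then show False
      proof cases
        case 1
        then show False using q(2) pre[of p] by (simp add: strict_prefix_def)
      next
        case 2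
        then show False using q(2) long[of q] prefix_length_less by blast
      next
        case 3
        then show False using q(2) Z unfolding bifix_code_def prefix_code_def by blast
      qed
    qed
    moreover have "p \<notin> insert ?x Z" if q: "q \<in> insert ?x Z" "strict_suffix p q" for p q
    proof
      have "p \<noteq> q" using q(2) by auto
      assume "p \<in> insert ?x Z"
      then consider "q = ?x" "p \<in> Z" | "q \<in> Z" "p = ?x" | "q \<in> Z" "p \<in> Z"
        using q \<open>p \<noteq> q\<close> by blast
      then show False
      proof cases
        case 1
        then show False using q(2) suf[of p] by (simp add: strict_suffix_def)
      next
        case 2
        then show False using q(2) long[of q] suffix_length_less by blast
      next
        case 3
        then show False using q(2) Z unfolding bifix_code_def suffix_code_def by blast
      qed
    qed
    ultimately have "bifix_code (insert ?x Z)"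
      using ne unfolding bifix_code_def prefix_code_def suffix_code_def by blast
    then show False
      using max t \<open>?x \<notin> Z\<close> unfolding maximal_bifix_code_def by blast
  qed
  then show "\<And>w. w \<in> S \<Longrightarrow> m \<le> length w \<Longrightarrow> \<exists>z\<in>Z. prefix z w"
    and "\<And>w. w \<in> S \<Longrightarrow> m \<le> length w \<Longrightarrow> \<exists>z\<in>Z. suffix z w"
    using prefix_complete_if_suffix_complete[OF fac irr Z _ bound]
      suffix_complete_if_prefix_complete[OF fac irr Z _ bound] by blast+
qed

subsection \<open>Generalized extension graphs\<close>

text \<open>
  The extension graph with respect to \<open>V\<close> arises from the one with respect to letters by replacing
  each right vertex \<open>b\<close> by the extension graph of \<open>w @ [b]\<close> with respect to the words \<open>y\<close> such that
  \<open>b # y\<close> is in \<open>V\<close>.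
\<close>

lemma bipartite_tree_right_extensions:
  fixes S U V :: "'a list set"
  assumes fac: "factorial S"
    and letters: "\<And>w. w \<in> S \<Longrightarrow>
      bipartite_tree {u \<in> U. u @ w \<in> S} {b. w @ [b] \<in> S} (\<lambda>u b. u @ w @ [b] \<in> S)"
    and "w \<in> S" and "\<And>x y. x \<in> V \<Longrightarrow> y \<in> V \<Longrightarrow> prefix x y \<Longrightarrow> x = y"
    and "\<And>v. v \<in> V \<Longrightarrow> length v \<le> n"
    and "\<And>y. w @ y \<in> S \<Longrightarrow> n \<le> length y \<Longrightarrow> \<exists>v\<in>V. prefix v y"
  shows "bipartite_tree {u \<in> U. u @ w \<in> S} {v \<in> V. w @ v \<in> S} (\<lambda>u v. u @ w @ v \<in> S)"
  using assms(3-6)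
proof (induction n arbitrary: w V)
  case 0
  \<comment> \<open>Completeness applied to the empty word yields an element of \<open>V\<close>.
    The only right vertex is then the empty word, and the graph is a star.\<close>
  then have "V = {[]}" using 0(4)[of "[]"] by auto
  have "bipartite_tree {u \<in> U. u @ w \<in> S} {v \<in> V. w @ v \<in> S} (\<lambda>u v. u @ w @ v \<in> S) \<longleftrightarrow>
      bipartite_tree {u \<in> U. u @ w \<in> S} {[] :: 'a list} (\<lambda>_ _. True)"
    by (intro bipartite_tree_cong) (use \<open>V = {[]}\<close> 0(1) in auto)
  then show ?case by (rule iffD2) (rule bipartite_tree_star)
next
  case (Suc n)
  show ?case
  proof (cases "[] \<in> V")
    case True
    \<comment> \<open>The empty word is a prefix of every word, so \<open>V\<close> has no other
      element and the graph is again a star.\<close>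
    then have "V = {[]}" using Suc.prems(2)[of "[]"] by auto
    have "bipartite_tree {u \<in> U. u @ w \<in> S} {v \<in> V. w @ v \<in> S} (\<lambda>u v. u @ w @ v \<in> S) \<longleftrightarrow>
        bipartite_tree {u \<in> U. u @ w \<in> S} {[] :: 'a list} (\<lambda>_ _. True)"
      by (intro bipartite_tree_cong) (use \<open>V = {[]}\<close> Suc.prems(1) in auto)
    then show ?thesis by (rule iffD2) (rule bipartite_tree_star)
  next
    case False
    then have hd: "v = hd v # tl v" if "v \<in> V" for v using that by (cases v) auto
    show ?thesis
    proof (rule bipartite_tree_subst[OF letters[OF Suc.prems(1)], where par = hd])
      fix v assume "v \<in> {v \<in> V. w @ v \<in> S}"
      then show "hd v \<in> {b. w @ [b] \<in> S}"
        using hd[of v] factorial_prefixD[OF fac, of "w @ [hd v]" "tl v"] by simp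
    next
      fix u v assume "v \<in> {v \<in> V. w @ v \<in> S}" "u @ w @ v \<in> S"
      then show "u @ w @ [hd v] \<in> S"
        using hd[of v] factorial_prefixD[OF fac, of "u @ w @ [hd v]" "tl v"] by simp
    next
      fix b assume b: "b \<in> {b. w @ [b] \<in> S}"
      define V' where "V' = {y. b # y \<in> V}"
      have "bipartite_tree {u \<in> U. u @ (w @ [b]) \<in> S} {y \<in> V'. (w @ [b]) @ y \<in> S}
          (\<lambda>u y. u @ (w @ [b]) @ y \<in> S)"
      proof (rule Suc.IH)
        show "w @ [b] \<in> S" using b by simp
        show "x = y" if "x \<in> V'" "y \<in> V'" "prefix x y" for x y
          using that Suc.prems(2)[of "b # x" "b # y"] by (simp add: V'_def)
        show "length v \<le> n" if "v \<in> V'" for v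
          using that Suc.prems(3)[of "b # v"] by (simp add: V'_def)
        show "\<exists>v\<in>V'. prefix v y" if y: "(w @ [b]) @ y \<in> S" "n \<le> length y" for y
        proof -
          obtain v where v: "v \<in> V" "prefix v (b # y)" using y Suc.prems(4)[of "b # y"] by auto
          then have "v = b # tl v" "prefix (tl v) y" using hd[of v] by (cases v; auto)+
          with v(1) show ?thesis unfolding V'_def by (metis mem_Collect_eq)
        qed
      qed
      then have "bipartite_tree (id ` {u \<in> U. u @ (w @ [b]) \<in> S})
          (Cons b ` {y \<in> V'. (w @ [b]) @ y \<in> S}) (\<lambda>u v. u @ w @ v \<in> S)"
        by (subst bipartite_tree_inj_images) auto
      moreover have "id ` {u \<in> U. u @ (w @ [b]) \<in> S} =
          {u \<in> {u \<in> U. u @ w \<in> S}. u @ w @ [b] \<in> S}"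
        using factorial_prefixD[OF fac, of _ "[b]"] by auto
      moreover have "Cons b ` {y \<in> V'. (w @ [b]) @ y \<in> S} =
          {v \<in> {v \<in> V. w @ v \<in> S}. hd v = b}"
      proof (intro equalityI subsetI)
        fix v assume v: "v \<in> {v \<in> {v \<in> V. w @ v \<in> S}. hd v = b}"
        then have "v = b # tl v" using hd by auto
        moreover have "tl v \<in> {y \<in> V'. (w @ [b]) @ y \<in> S}"
          using v calculation by (simp add: V'_def)
        ultimately show "v \<in> Cons b ` {y \<in> V'. (w @ [b]) @ y \<in> S}" by blast
      qed (auto simp: V'_def)
      ultimately show "bipartite_tree {u \<in> {u \<in> U. u @ w \<in> S}. u @ w @ [b] \<in> S}
          {v \<in> {v \<in> V. w @ v \<in> S}. hd v = b} (\<lambda>u v. u @ w @ v \<in> S)" by simp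
    qed
  qed
qed

text \<open>Letters are replaced by code words on the right first. Reversing all words then turns
  left letters into right ones, and the same substitution replaces them too.\<close>

lemma bipartite_tree_extensions:
  assumes fac: "factorial S"
    and letters: "\<And>w. w \<in> S \<Longrightarrow>
      bipartite_tree {a. [a] @ w \<in> S} {b. w @ [b] \<in> S} (\<lambda>a b. [a] @ w @ [b] \<in> S)"
    and Z: "bifix_code Z" and bound: "\<And>z. z \<in> Z \<Longrightarrow> length z \<le> m"
    and pre: "\<And>w. w \<in> S \<Longrightarrow> m \<le> length w \<Longrightarrow> \<exists>z\<in>Z. prefix z w"
    and suf: "\<And>w. w \<in> S \<Longrightarrow> m \<le> length w \<Longrightarrow> \<exists>z\<in>Z. suffix z w"
    and w: "w \<in> S"
  shows "bipartite_tree {u \<in> Z. u @ w \<in> S} {v \<in> Z. w @ v \<in> S} (\<lambda>u v. u @ w @ v \<in> S)"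
proof -
  \<comment> \<open>Letters as one-letter words, so that they can serve as left extensions.\<close>
  let ?U = "range (\<lambda>a. [a])"
  have U: "{u \<in> ?U. u @ w \<in> S} = (\<lambda>a. [a]) ` {a. [a] @ w \<in> S}" for w by auto
  have inj: "inj_on (\<lambda>a. [a]) X" for X :: "'a set" by (simp add: inj_on_def)
  have pc: "x = y" if "x \<in> Z" "y \<in> Z" "prefix x y" for x y
    using Z that prefix_code_unique[of Z x y y] by (simp add: bifix_code_def)
  have sc: "x = y" if "x \<in> rev ` Z" "y \<in> rev ` Z" "prefix x y" for x y
    using bifix_code_rev[OF Z] that prefix_code_unique[of "rev ` Z" x y y]
    by (simp add: bifix_code_def)
  have right: "bipartite_tree {a. [a] @ w \<in> S} {v \<in> Z. w @ v \<in> S} (\<lambda>a v. [a] @ w @ v \<in> S)"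
    if w: "w \<in> S" for w
  proof -
    have "bipartite_tree {u \<in> ?U. u @ w \<in> S} {v \<in> Z. w @ v \<in> S} (\<lambda>u v. u @ w @ v \<in> S)"
    proof (rule bipartite_tree_right_extensions[OF fac _ w pc bound])
      fix w assume "w \<in> S"
      have "bipartite_tree ((\<lambda>a. [a]) ` {a. [a] @ w \<in> S}) (id ` {b. w @ [b] \<in> S})
          (\<lambda>u b. u @ w @ [b] \<in> S)"
        using letters[OF \<open>w \<in> S\<close>] by (subst bipartite_tree_inj_images) (auto simp: inj)
      then show "bipartite_tree {u \<in> ?U. u @ w \<in> S} {b. w @ [b] \<in> S} (\<lambda>u b. u @ w @ [b] \<in> S)"
        unfolding U by simp
    qed (use pre factorial_suffixD[OF fac] in blast)+
    then have "bipartite_tree ((\<lambda>a. [a]) ` {a. [a] @ w \<in> S}) (id ` {v \<in> Z. w @ v \<in> S})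
        (\<lambda>u v. u @ w @ v \<in> S)" unfolding U by simp
    then show ?thesis by (subst (asm) bipartite_tree_inj_images) (auto simp: inj)
  qed
  \<comment> \<open>In the reversed language the reversed code words are already in place on the
    left; the fact \<open>right\<close>, flipped, is the hypothesis on letters.\<close>
  have "bipartite_tree {u \<in> rev ` Z. u @ rev w \<in> rev ` S} {v \<in> rev ` Z. rev w @ v \<in> rev ` S}
      (\<lambda>u v. u @ rev w @ v \<in> rev ` S)"
  proof (rule bipartite_tree_right_extensions[OF factorial_rev[OF fac] _ _ sc])
    fix w' assume "w' \<in> rev ` S"
    then have "rev w' \<in> S" by (simp add: mem_rev_image_iff)
    have eq: "rev ` {v \<in> Z. rev w' @ v \<in> S} = {u \<in> rev ` Z. u @ w' \<in> rev ` S}"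
      by (auto simp: mem_rev_image_iff)
    have "bipartite_tree (rev ` {v \<in> Z. rev w' @ v \<in> S}) (id ` {a. [a] @ rev w' \<in> S})
        (\<lambda>u b. u @ w' @ [b] \<in> rev ` S)"
      using bipartite_tree_flip[OF right[OF \<open>rev w' \<in> S\<close>]]
      by (subst bipartite_tree_inj_images) (auto simp: mem_rev_image_iff)
    then show "bipartite_tree {u \<in> rev ` Z. u @ w' \<in> rev ` S} {b. w' @ [b] \<in> rev ` S}
        (\<lambda>u b. u @ w' @ [b] \<in> rev ` S)"
      unfolding eq by (simp add: mem_rev_image_iff)
  next
    fix y assume "rev w @ y \<in> rev ` S" "m \<le> length y"
    then have "rev y \<in> S" "m \<le> length (rev y)"
      using factorial_prefixD[OF fac] by (auto simp: mem_rev_image_iff)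
    from suf[OF this] show "\<exists>v\<in>rev ` Z. prefix v y" by (auto simp: suffix_to_prefix)
  next
    fix v assume "v \<in> rev ` Z"
    then show "length v \<le> m" using bound by auto
  qed (use w in \<open>auto simp: mem_rev_image_iff\<close>)
  moreover have "{u \<in> rev ` Z. u @ rev w \<in> rev ` S} = rev ` {v \<in> Z. w @ v \<in> S}"
    "{v \<in> rev ` Z. rev w @ v \<in> rev ` S} = rev ` {u \<in> Z. u @ w \<in> S}"
    by (auto simp: mem_rev_image_iff)
  ultimately have "bipartite_tree {v \<in> Z. w @ v \<in> S} {u \<in> Z. u @ w \<in> S} (\<lambda>v u. u @ w @ v \<in> S)"
    by (simp add: bipartite_tree_inj_images mem_rev_image_iff)
  then show ?thesis by (rule bipartite_tree_flip)
qed

subsection \<open>Maximal bifix decodings\<close>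

text \<open>Maximality of \<open>Z\<close> enters through the two completeness conditions. The
  number \<open>m\<close> bounds the lengths of code words and is also a length from which
  completeness holds.\<close>

locale bifix_decoding =
  fixes A :: "'a set" and B :: "'b set" and S Z :: "'a list set"
    and f :: "'b list \<Rightarrow> 'a list" and m :: nat
  assumes recurrent: "uniformly_recurrent A S"
    and S_tree: "tree_set A S"
    and finite_A: "finite A"
    and finite_Z: "finite Z"
    and bifix: "bifix_code Z"
    and coding: "coding_morphism B A Z f"
    and bound: "\<And>z. z \<in> Z \<Longrightarrow> length z \<le> m"
    and prefix_complete: "\<And>w. w \<in> S \<Longrightarrow> m \<le> length w \<Longrightarrow> \<exists>z\<in>Z. prefix z w"
    and suffix_complete: "\<And>w. w \<in> S \<Longrightarrow> m \<le> length w \<Longrightarrow> \<exists>z\<in>Z. suffix z w"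
begin

section \<open>The coding morphism: unique factorization and cuts\<close>

abbreviation T :: "'b list set" where "T \<equiv> decoding B f S"

lemma S_factorial: "factorial S" and S_biextendable: "biextendable A S" and S_lists: "S \<subseteq> lists A"
  using S_tree by (simp_all add: tree_set_def)

lemma Nil_in_S: "[] \<in> S"
proof -
  obtain w where "w \<in> S" using recurrent by (auto simp: uniformly_recurrent_def)
  then show ?thesis using factorial_prefixD[OF S_factorial, of "[]" w] by simp
qed

lemma f_Nil: "f [] = []"
  and f_append: "u \<in> lists B \<Longrightarrow> v \<in> lists B \<Longrightarrow> f (u @ v) = f u @ f v"
  using coding by (simp_all add: coding_morphism_def word_morphism_def)

definition code :: "'b \<Rightarrow> 'a list" where "code b = f [b]"

lemma f_Cons: "b \<in> B \<Longrightarrow> v \<in> lists B \<Longrightarrow> f (b # v) = code b @ f v"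
  using f_append[of "[b]" v] by (simp add: code_def)

lemma f_snoc: "b \<in> B \<Longrightarrow> v \<in> lists B \<Longrightarrow> f (v @ [b]) = f v @ code b"
  using f_append[of v "[b]"] by (simp add: code_def)

lemma code_bij: "bij_betw code B Z"
  using coding by (simp add: coding_morphism_def code_def[abs_def])

lemma code_inj: "inj_on code B" and code_image: "code ` B = Z"
  using code_bij by (simp_all add: bij_betw_def)

lemma finite_B: "finite B"
  using code_bij finite_Z by (simp add: bij_betw_finite)

lemma code_mem: "b \<in> B \<Longrightarrow> code b \<in> Z"
  using code_image by blast

lemma code_nonempty: "b \<in> B \<Longrightarrow> code b \<noteq> []"
  using code_mem bifix by (metis bifix_code_def prefix_code_def)

lemma length_f: "v \<in> lists B \<Longrightarrow> length v \<le> length (f v)"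
proof (induction v)
  case (Cons b v)
  then have "1 \<le> length (code b)" using code_nonempty by (simp add: Suc_le_eq)
  with Cons show ?case by (simp add: f_Cons)
qed simp

text \<open>The last code words of \<open>f v\<close> and \<open>f u\<close> are suffixes of the
  same word, so they coincide in a suffix code and can be cancelled.\<close>

lemma suffix_of_suffix_f:
  assumes "u \<in> lists B" "v \<in> lists B" "suffix (f v) (f u)"
  shows "suffix v u"
  using assms
proof (induction v arbitrary: u rule: rev_induct)
  case (snoc b v)
  have b: "b \<in> B" "v \<in> lists B" using snoc.prems by auto
  have fv: "f (v @ [b]) = f v @ code b" using b by (simp add: f_snoc)
  have "u \<noteq> []"
    using snoc.prems(3) code_nonempty[OF b(1)] by (auto simp: fv f_Nil)
  then obtain u' c where u: "u = u' @ [c]" by (cases u rule: rev_cases) auto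
  have c: "c \<in> B" "u' \<in> lists B" using snoc.prems(1) by (auto simp: u)
  have fu: "f u = f u' @ code c" using c by (simp add: u f_snoc)
  have "suffix (code b) (f u)" using snoc.prems(3) unfolding fv by (rule suffix_appendD)
  moreover have "suffix (code c) (f u)" unfolding fu by (rule suffixI) (rule refl)
  ultimately have "code b = code c"
    using suffix_code_unique[of Z] bifix code_mem b c by (simp add: bifix_code_def)
  then have "b = c" using code_inj b c by (auto dest: inj_onD)
  have "suffix (f v @ code b) (f u' @ code c)" using snoc.prems(3) unfolding fv fu .
  then have "suffix (f v) (f u')" using \<open>code b = code c\<close> by simp
  then have "suffix v u'" using snoc.IH c b by simp
  then show ?case by (simp add: u \<open>b = c\<close>)
qed simp

lemma prefix_of_prefix_f:
  assumes "u \<in> lists B" "v \<in> lists B" "prefix (f v) (f u)"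
  shows "prefix v u"
  using assms
proof (induction v arbitrary: u rule: list.induct)
  case (Cons b v)
  have b: "b \<in> B" "v \<in> lists B" using Cons.prems by auto
  have fv: "f (b # v) = code b @ f v" using b by (simp add: f_Cons)
  have "u \<noteq> []"
    using Cons.prems(3) code_nonempty[OF b(1)] by (auto simp: fv f_Nil)
  then obtain c u' where u: "u = c # u'" by (cases u) auto
  have c: "c \<in> B" "u' \<in> lists B" using Cons.prems(1) by (auto simp: u)
  have fu: "f u = code c @ f u'" using c by (simp add: u f_Cons)
  have "prefix (code b) (f u)" using Cons.prems(3) unfolding fv by (rule append_prefixD)
  moreover have "prefix (code c) (f u)" unfolding fu by (rule prefixI) (rule refl)
  ultimately have "code b = code c"
    using prefix_code_unique[of Z] bifix code_mem b c by (simp add: bifix_code_def)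
  then have "b = c" using code_inj b c by (auto dest: inj_onD)
  have "prefix (code b @ f v) (code c @ f u')" using Cons.prems(3) unfolding fv fu .
  then have "prefix (f v) (f u')" using \<open>code b = code c\<close> by simp
  then have "prefix v u'" using Cons.IH c b by simp
  then show ?case by (simp add: u \<open>b = c\<close>)
qed simp

text \<open>No code word is longer than \<open>c\<close>, so a code word that begins before
  \<open>c\<close> and reaches its left end stops inside \<open>c\<close> or at its right
  end.\<close>

lemma cut_in_long_factor:
  assumes "v \<in> lists B" "f v = s @ c @ t" "m \<le> length c"
  shows "\<exists>v1 v2 c1 c2. v = v1 @ v2 \<and> c = c1 @ c2 \<and> f v1 = s @ c1 \<and> f v2 = c2 @ t"
  using assms
proof (induction v arbitrary: s rule: list.induct)
  case Nil
  then show ?case by (auto simp: f_Nil)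
next
  case (Cons b v)
  have b: "b \<in> B" "v \<in> lists B" using Cons.prems(1) by auto
  have fv: "code b @ f v = s @ c @ t" using Cons.prems b by (simp add: f_Cons)
  \<comment> \<open>The factor \<open>c\<close> begins at the cut before \<open>b\<close>, at or
    after the end of \<open>code b\<close>, or inside \<open>code b\<close>.\<close>
  consider "s = []" | s' where "s = code b @ s'" "f v = s' @ c @ t"
    | c1 where "code b = s @ c1" "c @ t = c1 @ f v" "s \<noteq> []"
  proof -
    obtain us where "code b = s @ us \<and> us @ f v = c @ t \<or> code b @ us = s \<and> f v = us @ c @ t"
      using append_eq_append_conv2[THEN iffD1, OF fv] by blast
    then show thesis using that by fastforce
  qed
  then show ?case
  proof cases
    case 1
    show ?thesis
      by (rule exI[of _ "[]"], rule exI[of _ "b # v"], rule exI[of _ "[]"], rule exI[of _ c])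
        (use 1 Cons.prems in \<open>simp add: f_Nil\<close>)
  next
    case 2
    obtain v1 v2 c1 c2 where v: "v = v1 @ v2" "c = c1 @ c2" "f v1 = s' @ c1" "f v2 = c2 @ t"
      using Cons.IH[OF b(2) 2(2) Cons.prems(3)] by blast
    then have "f (b # v1) = s @ c1" using b 2(1) by (simp add: f_Cons)
    with v show ?thesis
      by (intro exI[of _ "b # v1"] exI[of _ v2] exI[of _ c1] exI[of _ c2]) simp
  next
    case 3
    have "length c1 \<le> length c"
      using bound[OF code_mem[OF b(1)]] 3(1) Cons.prems(3) by simp
    moreover have "prefix c1 (c @ t)" unfolding 3(2) by simp
    ultimately have "prefix c1 c" using prefix_length_prefix[of c1 "c @ t" c] by simp
    then obtain c2 where "c = c1 @ c2" by (auto simp: prefix_def)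
    then have "b # v = [b] @ v \<and> c = c1 @ c2 \<and> f [b] = s @ c1 \<and> f v = c2 @ t"
      using 3 by (simp add: code_def)
    then show ?thesis by blast
  qed
qed

section \<open>The decoding is a tree set\<close>

lemma T_D: "w \<in> T \<Longrightarrow> w \<in> lists B" "w \<in> T \<Longrightarrow> f w \<in> S"
  by (simp_all add: decoding_def)

lemma T_I: "w \<in> lists B \<Longrightarrow> f w \<in> S \<Longrightarrow> w \<in> T"
  by (simp add: decoding_def)

lemma T_factorial: "factorial T"
  unfolding factorial_def
proof (intro ballI allI impI)
  fix w u
  assume w: "w \<in> T" "sublist u w"
  then obtain p q where pq: "w = p @ u @ q" by (auto simp: sublist_def)
  have l: "p \<in> lists B" "u \<in> lists B" "q \<in> lists B" using T_D(1)[OF w(1)] by (auto simp: pq)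
  then have "f w = f p @ f u @ f q" by (simp add: pq f_append)
  then have "f u \<in> S" using T_D(2)[OF w(1)] factorialD[OF S_factorial] by simp
  then show "u \<in> T" using l by (intro T_I)
qed

text \<open>Extend \<open>f w\<close> by \<open>m\<close> letters on each side in \<open>S\<close>;
  completeness provides code words adjacent to \<open>f w\<close> within these extensions.\<close>

lemma T_biextendable: "biextendable B T"
  unfolding biextendable_def
proof
  fix w assume w: "w \<in> T"
  obtain l r where lr: "length l = m" "length r = m" "l @ f w @ r \<in> S"
    using biextendable_long[OF S_biextendable T_D(2)[OF w]] by blast
  have "l \<in> S" "r \<in> S"
    using lr(3) factorialD[OF S_factorial, of "[]" l] factorialD[OF S_factorial, of "l @ f w" r "[]"]
    by auto
  then obtain x y where x: "x \<in> Z" "suffix x l" and y: "y \<in> Z" "prefix y r"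
    using suffix_complete[of l] prefix_complete[of r] lr by auto
  then obtain a b where ab: "a \<in> B" "b \<in> B" "x = code a" "y = code b" using code_image by blast
  have l: "w \<in> lists B" using T_D(1)[OF w] .
  obtain l' r' where "l = l' @ x" "r = y @ r'" using x y by (auto simp: suffix_def prefix_def)
  then have "x @ f w @ y \<in> S"
    using lr(3) factorialD[OF S_factorial, of l' "x @ f w @ y" r'] by simp
  then have "f (a # w @ [b]) \<in> S" using ab l by (simp add: f_Cons f_snoc)
  then have "[a] @ w @ [b] \<in> T" using ab l by (intro T_I) auto
  then show "\<exists>a\<in>B. \<exists>b\<in>B. [a] @ w @ [b] \<in> T" using ab by blast
qed

lemma Nil_in_T: "[] \<in> T"
  using Nil_in_S by (intro T_I) (auto simp: f_Nil)

lemma S_bipartite_tree: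
  assumes "w \<in> S"
  shows "bipartite_tree {a. [a] @ w \<in> S} {b. w @ [b] \<in> S} (\<lambda>a b. [a] @ w @ [b] \<in> S)"
proof -
  have "left_letters A S w = {a. [a] @ w \<in> S}" "right_letters A S w = {b. w @ [b] \<in> S}"
    using S_lists by (auto simp: left_letters_def right_letters_def)
  moreover have "undirected_tree (extension_graph A S w)"
    using S_tree assms by (simp add: tree_set_def)
  ultimately show ?thesis
    by (simp add: undirected_tree_extension_graph_iff[OF finite_A S_factorial])
qed

lemma T_letters:
  assumes "w \<in> lists B"
  shows "left_letters B T w = {b \<in> B. code b @ f w \<in> S}"
    and "right_letters B T w = {b \<in> B. f w @ code b \<in> S}"
proof -
  have "f (b # w) = code b @ f w" "f (w @ [b]) = f w @ code b" if "b \<in> B" for b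
    using that assms by (simp_all only: f_Cons f_snoc)
  then show "left_letters B T w = {b \<in> B. code b @ f w \<in> S}"
    and "right_letters B T w = {b \<in> B. f w @ code b \<in> S}"
    using assms by (auto simp: left_letters_def right_letters_def decoding_def)
qed

lemma T_bipartite_tree:
  assumes w: "w \<in> T"
  shows "bipartite_tree (left_letters B T w) (right_letters B T w) (\<lambda>a b. [a] @ w @ [b] \<in> T)"
proof -
  note l = T_D(1)[OF w]
  let ?g = code
  have "bipartite_tree {u \<in> Z. u @ f w \<in> S} {v \<in> Z. f w @ v \<in> S} (\<lambda>u v. u @ f w @ v \<in> S)"
    using bipartite_tree_extensions[OF S_factorial S_bipartite_tree bifix bound prefix_complete
        suffix_complete T_D(2)[OF w]] by simp
  moreover have "{u \<in> Z. u @ f w \<in> S} = ?g ` left_letters B T w"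
    "{v \<in> Z. f w @ v \<in> S} = ?g ` right_letters B T w"
    unfolding T_letters[OF l] using code_image by auto
  moreover have "inj_on ?g (left_letters B T w)" "inj_on ?g (right_letters B T w)"
    using code_inj by (auto simp: left_letters_def right_letters_def intro: inj_on_subset)
  ultimately have "bipartite_tree (left_letters B T w) (right_letters B T w)
      (\<lambda>a b. code a @ f w @ code b \<in> S)"
    by (simp add: bipartite_tree_inj_images)
  moreover have "code a @ f w @ code b \<in> S \<longleftrightarrow> [a] @ w @ [b] \<in> T"
    if "a \<in> left_letters B T w" "b \<in> right_letters B T w" for a b
    using that l by (auto simp: left_letters_def right_letters_def decoding_def f_Cons f_snoc)
  ultimately show ?thesis
    by (rule bipartite_tree_cong[OF refl refl, THEN iffD1, rotated])
qed

lemma tree_set_T: "tree_set B T"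
  unfolding tree_set_def
proof (intro conjI ballI)
  show "T \<subseteq> lists B" by (auto simp: decoding_def)
  fix w assume w: "w \<in> T"
  \<comment> \<open>Biextendability supplies a vertex, so the extension graph is not empty.\<close>
  then obtain a b where ab: "a \<in> B" "[a] @ w @ [b] \<in> T"
    using T_biextendable by (auto simp: biextendable_def)
  then have "a \<in> left_letters B T w"
    using factorial_prefixD[OF T_factorial, of "[a] @ w" "[b]"] by (simp add: left_letters_def)
  then show "undirected_tree (extension_graph B T w)"
    using T_bipartite_tree[OF w]
    unfolding undirected_tree_extension_graph_iff[OF finite_B T_factorial] by blast
qed (rule T_factorial T_biextendable)+

section \<open>Uniform recurrence of the decoding\<close>

text \<open>
  Fix a word \<open>c\<close> of length at least \<open>m\<close>, so that every parse has a cut inside \<open>c\<close>. As a context of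
  \<open>c\<close> grows, the set of cuts inside \<open>c\<close> which come from words of \<open>L\<close> shrinks; in a context where it
  has minimal size, such a cut survives in every further extension.
\<close>

lemma long_words_extend_in_subset:
  assumes L: "L \<subseteq> T" "factorial L"
  shows "\<exists>N. \<forall>v\<in>L. N \<le> length v \<longrightarrow> (\<forall>a b. [a] @ v @ [b] \<in> T \<longrightarrow> [a] @ v @ [b] \<in> L)"
proof -
  obtain c where c: "c \<in> S" "m \<le> length c"
  proof -
    obtain l r where "length l = m" "l @ [] @ r \<in> S"
      using biextendable_long[OF S_biextendable Nil_in_S] by blast
    then show ?thesis using that[of "l @ r"] by simp
  qed
  \<comment> \<open>The cuts inside \<open>c\<close> that occur in some word of \<open>L\<close>
    whose image contains \<open>c\<close> in the context \<open>p\<close>, \<open>q\<close>.\<close>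
  define C where "C p q = {i. i \<le> length c \<and> (\<exists>v1 v2 l r. v1 @ v2 \<in> L \<and>
      f v1 = l @ p @ take i c \<and> f v2 = drop i c @ q @ r)}" for p q
  have fin: "finite (C p q)" for p q
    by (rule finite_subset[of _ "{..length c}"]) (auto simp: C_def)
  have mono: "C (p' @ p) (q @ q') \<subseteq> C p q" for p p' q q'
  proof
    fix i assume "i \<in> C (p' @ p) (q @ q')"
    then obtain v1 v2 l r where "i \<le> length c" "v1 @ v2 \<in> L"
      "f v1 = (l @ p') @ p @ take i c" "f v2 = drop i c @ q @ (q' @ r)" by (auto simp: C_def)
    then show "i \<in> C p q" unfolding C_def by blast
  qed
  have "\<exists>pq. fst pq @ c @ snd pq \<in> S" using c by (intro exI[of _ "([], [])"]) simp
  from ex_has_least_nat[of "\<lambda>pq. fst pq @ c @ snd pq \<in> S" _ "\<lambda>pq. card (C (fst pq) (snd pq))"] this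
  obtain pq where "fst pq @ c @ snd pq \<in> S" "\<And>pq'. fst pq' @ c @ snd pq' \<in> S \<Longrightarrow>
      card (C (fst pq) (snd pq)) \<le> card (C (fst pq') (snd pq'))" by blast
  then obtain p q where pq: "p @ c @ q \<in> S"
    and least: "\<And>p' q'. p' @ c @ q' \<in> S \<Longrightarrow> card (C p q) \<le> card (C p' q')"
    by (metis fst_conv snd_conv)
  \<comment> \<open>A larger context can only lose cuts, and by minimality of the cardinality it
    loses none.\<close>
  have stable: "C (p' @ p) (q @ q') = C p q" if "(p' @ p) @ c @ (q @ q') \<in> S" for p' q'
    using card_subset_eq[OF fin mono] card_mono[OF fin mono] least[OF that] by (metis le_antisym)
  \<comment> \<open>Every word of \<open>S\<close> of length \<open>N\<close> contains the minimal
    context, and so does \<open>f v\<close> for \<open>v\<close> of length at least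
    \<open>N\<close>, because \<open>f\<close> does not shorten words.\<close>
  obtain N where N: "\<And>w. w \<in> S \<Longrightarrow> length w = N \<Longrightarrow> sublist (p @ c @ q) w"
    using recurrent pq unfolding uniformly_recurrent_def by blast
  have "[a] @ v @ [b] \<in> L" if v: "v \<in> L" "N \<le> length v" and ab: "[a] @ v @ [b] \<in> T" for v a b
  proof -
    have "v \<in> T" using v L by blast
    note vl = T_D(1)[OF this] and fv = T_D(2)[OF this]
    have "take N (f v) \<in> S" using fv factorial_prefixD[OF S_factorial, of _ "drop N (f v)"] by simp
    moreover have "length (take N (f v)) = N" using length_f[OF vl] v(2) by simp
    ultimately have "sublist (p @ c @ q) (take N (f v))" by (rule N)
    then obtain s t where "take N (f v) = s @ (p @ c @ q) @ t" by (auto simp: sublist_def)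
    then have "f v = s @ (p @ c @ q) @ t @ drop N (f v)" by (metis append.assoc append_take_drop_id)
    then obtain t where st: "f v = (s @ p) @ c @ (q @ t)" by simp
    obtain v1 v2 c1 c2 where v12: "v = v1 @ v2" and c12: "c = c1 @ c2"
      and f12: "f v1 = (s @ p) @ c1" "f v2 = c2 @ q @ t"
      using cut_in_long_factor[OF vl st c(2)] by blast
    have l: "v1 \<in> lists B" "v2 \<in> lists B" "a \<in> B" "b \<in> B"
      using T_D(1)[OF ab] by (auto simp: v12)
    have "length c1 \<in> C p q"
      unfolding C_def using v(1) f12 by (auto simp: v12 c12)
    moreover have "f ([a] @ v @ [b]) = code a @ f v @ code b"
      using l vl by (simp add: f_Cons f_snoc)
    then have "((code a @ s) @ p) @ c @ (q @ (t @ code b)) \<in> S"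
      using T_D(2)[OF ab] by (simp add: st)
    \<comment> \<open>The cut of \<open>v\<close> inside \<open>c\<close> survives when the context
      is enlarged to all of \<open>f ([a] @ v @ [b])\<close>, so it is realized by a word
      \<open>u1 @ u2\<close> of \<open>L\<close>.\<close>
    ultimately have "length c1 \<in> C ((code a @ s) @ p) (q @ (t @ code b))"
      using stable by blast
    then obtain u1 u2 l' r' where u: "u1 @ u2 \<in> L"
      "f u1 = l' @ ((code a @ s) @ p) @ c1" "f u2 = c2 @ (q @ (t @ code b)) @ r'"
      by (auto simp: C_def c12)
    have ul: "u1 \<in> lists B" "u2 \<in> lists B" using T_D(1) u(1) L(1) by (meson append_in_lists_conv subsetD)+
    \<comment> \<open>Since both factorizations have a cut at the same place in \<open>c\<close>,
      the bifix property can be used outward from it and shows that \<open>[a] @ v @ [b]\<close> is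
      a factor of \<open>u1 @ u2\<close>.\<close>
    have "suffix (f ([a] @ v1)) (f u1)"
      unfolding u(2) using l by (simp add: f_Cons f12 suffix_def)
    then have "suffix ([a] @ v1) u1" using ul l by (intro suffix_of_suffix_f) auto
    moreover have "prefix (f (v2 @ [b])) (f u2)"
      unfolding u(3) using l by (simp add: f_snoc f12 prefix_def)
    then have "prefix (v2 @ [b]) u2" using ul l by (intro prefix_of_prefix_f) auto
    ultimately obtain x y where "u1 = x @ [a] @ v1" "u2 = (v2 @ [b]) @ y"
      by (auto simp: suffix_def prefix_def)
    then have "u1 @ u2 = x @ ([a] @ v @ [b]) @ y" by (simp add: v12)
    then show ?thesis using u(1) factorialD[OF L(2)] by metis
  qed
  then show ?thesis by blast
qed

text \<open>Sufficiently long words of \<open>L\<close> have all their extensions in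
  \<open>L\<close>. Connectedness of extension graphs lowers the required length one by one to 0,
  and then every word of \<open>T\<close> is built from the empty word inside
  \<open>L\<close>.\<close>

lemma biextendable_subset_eq:
  assumes L: "L \<subseteq> T" "factorial L" "biextendable B L" "[] \<in> L"
  shows "L = T"
proof -
  define ext where "ext k \<longleftrightarrow> (\<forall>v\<in>L. k \<le> length v \<longrightarrow>
      (\<forall>b. ([b] @ v \<in> T \<longrightarrow> [b] @ v \<in> L) \<and> (v @ [b] \<in> T \<longrightarrow> v @ [b] \<in> L)))" for k
  obtain N where N: "\<And>v a b. v \<in> L \<Longrightarrow> N \<le> length v \<Longrightarrow> [a] @ v @ [b] \<in> T \<Longrightarrow> [a] @ v @ [b] \<in> L"
    using long_words_extend_in_subset[OF L(1,2)] by blast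
  have "ext N"
    unfolding ext_def
  proof (intro ballI impI allI conjI)
    fix v b assume v: "v \<in> L" "N \<le> length v"
    {
      assume "[b] @ v \<in> T"
      \<comment> \<open>The fact \<open>N\<close> concerns two-sided extensions, so the given one is
        first prolonged in \<open>T\<close>.\<close>
      then obtain a c where "([a] @ [b] @ v) @ [c] \<in> T"
        using T_biextendable unfolding biextendable_def by fastforce
      then have "[b] @ v @ [c] \<in> T" using factorial_suffixD[OF T_factorial, of "[a]"] by simp
      then have "[b] @ v @ [c] \<in> L" using N v by blast
      then show "[b] @ v \<in> L" using factorial_prefixD[OF L(2), of "[b] @ v" "[c]"] by simp
    next
      assume "v @ [b] \<in> T"
      then obtain a c where "([a] @ v @ [b]) @ [c] \<in> T"
        using T_biextendable unfolding biextendable_def by fastforce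
      then have "[a] @ v @ [b] \<in> T" using factorial_prefixD[OF T_factorial] by blast
      then have "[a] @ v @ [b] \<in> L" using N v by blast
      then show "v @ [b] \<in> L" using factorial_suffixD[OF L(2)] by blast
    }
  qed
  have step: "ext k" if "ext (Suc k)" for k
    unfolding ext_def
  proof (intro ballI impI)
    fix v assume v: "v \<in> L" "k \<le> length v"
    have vT: "v \<in> T" using v L by blast
    have extL: "[b] @ w \<in> T \<Longrightarrow> [b] @ w \<in> L" "w @ [b] \<in> T \<Longrightarrow> w @ [b] \<in> L"
      if "w \<in> L" "length w = Suc (length v)" for w b
      using \<open>ext (Suc k)\<close> that v(2) unfolding ext_def by auto
    \<comment> \<open>Membership in \<open>L\<close> is a colouring of the extension graph of
      \<open>v\<close> that is constant along edges: \<open>[a] @ v\<close> and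
      \<open>v @ [b]\<close> are longer than \<open>v\<close>, so \<open>ext (Suc k)\<close> applies
      to them.\<close>
    have edge: "[a] @ v \<in> L \<longleftrightarrow> v @ [b] \<in> L" if "[a] @ v @ [b] \<in> T" for a b
    proof
      assume "[a] @ v \<in> L"
      from extL(2)[OF this] that have "[a] @ v @ [b] \<in> L" by simp
      then show "v @ [b] \<in> L" by (rule factorial_suffixD[OF L(2)])
    next
      assume "v @ [b] \<in> L"
      from extL(1)[OF this _ that] have "([a] @ v) @ [b] \<in> L" by simp
      then show "[a] @ v \<in> L" by (rule factorial_prefixD[OF L(2)])
    qed
    obtain c where c: "\<And>a. a \<in> left_letters B T v \<Longrightarrow> ([a] @ v \<in> L) = c"
      "\<And>b. b \<in> right_letters B T v \<Longrightarrow> (v @ [b] \<in> L) = c"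
      by (rule bipartite_treeD[OF T_bipartite_tree[OF vT],
            of "\<lambda>a. [a] @ v \<in> L" "\<lambda>b. v @ [b] \<in> L"]) (use edge in auto)
    \<comment> \<open>Biextendability of \<open>L\<close> gives one vertex with colour true, so all
      vertices have it.\<close>
    obtain a b where ab: "a \<in> B" "b \<in> B" "[a] @ v @ [b] \<in> L"
      using L(3) v(1) unfolding biextendable_def by blast
    then have "[a] @ v \<in> L" using factorial_prefixD[OF L(2), of "[a] @ v" "[b]"] by simp
    moreover from this have "a \<in> left_letters B T v"
      using ab L(1) by (auto simp: left_letters_def)
    ultimately have c_True: c using c(1) by blast
    show "\<forall>b. ([b] @ v \<in> T \<longrightarrow> [b] @ v \<in> L) \<and> (v @ [b] \<in> T \<longrightarrow> v @ [b] \<in> L)"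
    proof (intro allI conjI impI)
      fix b assume b: "[b] @ v \<in> T"
      then have "b \<in> left_letters B T v" using T_D(1)[OF b] by (simp add: left_letters_def)
      then show "[b] @ v \<in> L" using c(1) c_True by blast
    next
      fix b assume b: "v @ [b] \<in> T"
      then have "b \<in> right_letters B T v" using T_D(1)[OF b] by (simp add: right_letters_def)
      then show "v @ [b] \<in> L" using c(2) c_True by blast
    qed
  qed
  have "ext 0" using \<open>ext N\<close> by (induction N) (blast intro: step)+
  have "w \<in> L" if "w \<in> T" for w
    using that
  proof (induction w)
    case (Cons b w)
    then have "w \<in> T" using factorial_suffixD[OF T_factorial, of "[b]" w] by simp
    with Cons \<open>ext 0\<close> show ?case by (simp add: ext_def)
  qed (rule L(4))
  with L(1) show ?thesis by blast
qed

text \<open>If \<open>u\<close> is avoided by words of every positive length, the words with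
  arbitrarily long two-sided extensions avoiding \<open>u\<close> form a factorial biextendable
  subset of \<open>T\<close>. It would equal \<open>T\<close>, although it does not contain
  \<open>u\<close>.\<close>

lemma uniformly_recurrent_T: "uniformly_recurrent B T"
proof -
  have "\<exists>n\<ge>1. \<forall>w\<in>T. length w = n \<longrightarrow> sublist u w" if u: "u \<in> T" for u
  proof (rule ccontr)
    assume "\<not> ?thesis"
    then have avoid: "\<exists>w\<in>T. length w = n \<and> \<not> sublist u w" if "1 \<le> n" for n
      using that by blast
    define L where "L = {w. \<forall>n. \<exists>l r. n \<le> length l \<and> n \<le> length r \<and>
        l @ w @ r \<in> T \<and> \<not> sublist u (l @ w @ r)}"
    have "L \<subseteq> T" using factorialD[OF T_factorial] by (auto simp: L_def)
    moreover have "factorial L"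
      unfolding factorial_def
    proof (intro ballI allI impI)
      fix w x assume "w \<in> L" "sublist x w"
      then obtain p q where w: "w = p @ x @ q" by (auto simp: sublist_def)
      show "x \<in> L" unfolding L_def
      proof (intro CollectI allI)
        fix n
        obtain l r where "n \<le> length l" "n \<le> length r" "l @ w @ r \<in> T" "\<not> sublist u (l @ w @ r)"
          using \<open>w \<in> L\<close> unfolding L_def by blast
        then show "\<exists>l r. n \<le> length l \<and> n \<le> length r \<and> l @ x @ r \<in> T \<and> \<not> sublist u (l @ x @ r)"
          by (intro exI[of _ "l @ p"] exI[of _ "q @ r"]) (simp add: w)
      qed
    qed
    moreover have "biextendable B L"
      unfolding biextendable_def
    proof (rule ballI, rule ccontr)
      fix w assume w: "w \<in> L" and no: "\<not> (\<exists>a\<in>B. \<exists>b\<in>B. [a] @ w @ [b] \<in> L)"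
      define ok where "ok n ab \<longleftrightarrow> (\<exists>l r. n \<le> length l \<and> n \<le> length r \<and>
        l @ ([fst ab] @ w @ [snd ab]) @ r \<in> T \<and> \<not> sublist u (l @ ([fst ab] @ w @ [snd ab]) @ r))"
        for n and ab :: "'b \<times> 'b"
      have anti: "ok n ab" if "ok k ab" "n \<le> k" for n k ab
        using that unfolding ok_def by (meson order_trans)
      have "\<forall>ab\<in>B \<times> B. \<exists>n. \<not> ok n ab"
        using no unfolding L_def ok_def by fastforce
      from bchoice[OF this] obtain h where h: "\<forall>ab\<in>B \<times> B. \<not> ok (h ab) ab" by blast
      \<comment> \<open>There are finitely many pairs of letters. If each of them failed at some
        depth, all would fail at depth \<open>n\<close>, although \<open>w\<close> has an extension
        of depth \<open>Suc n\<close>.\<close>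
      define n where "n = Max (insert 0 (h ` (B \<times> B)))"
      have n: "h ab \<le> n" if "ab \<in> B \<times> B" for ab
        unfolding n_def using finite_B that by (intro Max_ge) auto
      obtain l r where lr: "Suc n \<le> length l" "Suc n \<le> length r" "l @ w @ r \<in> T"
        "\<not> sublist u (l @ w @ r)" using w unfolding L_def by blast
      obtain l' a where l: "l = l' @ [a]" using lr(1) by (cases l rule: rev_cases) auto
      obtain b r' where r: "r = b # r'" using lr(2) by (cases r) auto
      have ab: "(a, b) \<in> B \<times> B" using T_D(1)[OF lr(3)] by (auto simp: l r)
      have "ok n (a, b)"
        unfolding ok_def using lr by (intro exI[of _ l'] exI[of _ r']) (simp add: l r)
      then show False using anti n[OF ab] h ab by blast
    qed
    moreover have "[] \<in> L"
      unfolding L_def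
    proof (intro CollectI allI)
      fix n
      \<comment> \<open>Cutting after \<open>n\<close> letters leaves at least \<open>n\<close>
        letters on both sides; the extra letter makes the length positive, as \<open>avoid\<close>
        requires.\<close>
      obtain w where w: "w \<in> T" "length w = Suc (n + n)" "\<not> sublist u w" using avoid by auto
      then show "\<exists>l r. n \<le> length l \<and> n \<le> length r \<and> l @ [] @ r \<in> T \<and> \<not> sublist u (l @ [] @ r)"
        by (intro exI[of _ "take n w"] exI[of _ "drop n w"]) simp
    qed
    ultimately have "L = T" by (rule biextendable_subset_eq)
    then have "u \<in> L" using u by simp
    then show False unfolding L_def by (auto simp: sublist_appendI)
  qed
  moreover have "right_extendable B T"
    unfolding right_extendable_def
  proof
    fix w assume "w \<in> T"
    then obtain a b where "b \<in> B" "[a] @ w @ [b] \<in> T"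
      using T_biextendable unfolding biextendable_def by blast
    then show "\<exists>b\<in>B. w @ [b] \<in> T" using factorial_suffixD[OF T_factorial] by blast
  qed
  moreover have "T \<subseteq> lists B" by (auto simp: decoding_def)
  ultimately show ?thesis
    using T_factorial Nil_in_T unfolding uniformly_recurrent_def by blast
qed

end

theorem theorem6p1:
  fixes A :: "'a set" and B :: "'b set"
    and S Z :: "'a list set" and f :: "'b list \<Rightarrow> 'a list"
  assumes "finite A" and "A \<noteq> {}"
    and "uniformly_recurrent A S" and "tree_set A S"
    and "finite Z" and "maximal_bifix_code S Z"
    and "coding_morphism B A Z f"
  shows "uniformly_recurrent B (decoding B f S) \<and> tree_set B (decoding B f S)"
proof -
  \<comment> \<open>Inserting 0 makes the maximum meaningful for empty \<open>Z\<close>, and the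
    successor makes \<open>m\<close> positive, as the completeness lemma demands.\<close>
  define m where "m = Suc (Max (insert 0 (length ` Z)))"
  have bound: "length z \<le> m" if "z \<in> Z" for z
    unfolding m_def using assms(5) that by (intro le_SucI Max_ge) auto
  have fac: "factorial S" using assms(4) by (simp add: tree_set_def)
  have "0 < m" by (simp add: m_def)
  note complete = maximal_bifix_code_complete[OF fac uniformly_recurrent_irreducible[OF assms(3)]
      assms(6) bound \<open>0 < m\<close>]
  interpret bifix_decoding A B S Z f m
    using assms bound complete by unfold_locales (auto simp: maximal_bifix_code_def)
  show ?thesis using uniformly_recurrent_T tree_set_T by blast
qed

end
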